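(* Let $b_-\ge 1$ and let $K_{\mathbb{R}}+iC$ be the tube domain model of the Grassmannian of a real quadratic space $V$ of signature $(2,b_-)$. For any integer $m$ define $R_m^{(b_-)}$ to be the operator $$R_m^{(b_-)}=(Y^2)^{\frac{b_-}{2}-m-1}\,\Delta_{K_{\mathbb{C}}}^{h}\,(Y^2)^{m+1-\frac{b_-}{2}}=\Delta_{K_{\mathbb{C}}}^{h}-\frac{i(2m+2-b_-)}{Y^2}D^{*}-\frac{m(2m+2-b_-)}{2Y^2},$$ and define $$L^{(b_-)}=(Y^2)^2\,\overline{R_0^{(b_-)}}=(Y^2)^{\frac{b_-}{2}+1}\Delta_{K_{\mathbb{C}}}^{\overline{h}}(Y^2)^{1-\frac{b_-}{2}}=(Y^2)^2\Delta_{K_{\mathbb{C}}}^{\overline{h}}+iY^2(2-b_-)\overline{D^{*}}.$$ Then the equalities $$(R_m^{(b_-)}F)[M]_{m+2}=R_m^{(b_-)}\big(F[M]_m\big),\qquad (L^{(b_-)}F)[M]_{m-2}=L^{(b_-)}\big(F[M]_m\big)$$ hold for every integer $m$, every $\mathcal{C}^2$ function $F:K_{\mathbb{R}}+iC\to\mathbb{C}$ and every $M\in O^{+}(V)$.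
   Context: Geometry. $V$ is a real vector space with a non-degenerate symmetric bilinear form $(\cdot,\cdot)$ of signature $(2,b_-)$, extended $\mathbb{C}$-bilinearly to $V_{\mathbb{C}}=V\otimes_{\mathbb{R}}\mathbb{C}$; write $x^2=(x,x)$. The set $P=\{Z_V\in V_{\mathbb{C}}: Z_V^2=0,\ (Z_V,\overline{Z_V})>0\}$ has two connected components, interchanged by complex conjugation; fix one of them, $P^{+}$. Fix a non-zero isotropic vector $z\in V$ and some $\zeta\in V$ with $(z,\zeta)=1$. The space $K_{\mathbb{R}}=z^{\perp}/\mathbb{R}z$ is identified with $\{z,\zeta\}^{\perp}$; it is Lorentzian of signature $(1,b_- -1)$, and $K_{\mathbb{C}}$ is its complexification. For $Z=X+iY\in K_{\mathbb{C}}$ put $Z_{V,Z}=Z+\zeta-\frac{Z^2+\zeta^2}{2}z\in V_{\mathbb{C}}$. The positive cone $C\subset K_{\mathbb{R}}$ is the cone of those $Y$ with $Y^2>0$ such that $Z_{V,X+iY}\in P^{+}$ (for one, equivalently every, $X\in K_{\mathbb{R}}$). The tube domain is $K_{\mathbb{R}}+iC\subset K_{\mathbb{C}}$; for $Z=X+iY$ in it, $Y^2=(Y,Y)>0$. Group action. $O^{+}(V)$ is the subgroup of $O(V)$ of elements preserving the orientation on the positive definite part (equivalently, preserving $P^{+}$). For $M\in O^{+}(V)$ and $Z\in K_{\mathbb{R}}+iC$, the point $MZ\in K_{\mathbb{R}}+iC$ and the number $J(M,Z)\in\mathbb{C}^{*}$ are defined by $M(Z_{V,Z})=J(M,Z)Z_{V,MZ}$,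 so that $J(M,Z)=(MZ_{V,Z},z)$. For an integer $m$ the slash operator is $F[M]_m(Z)=J(M,Z)^{-m}F(MZ)$. Differential operators. Take an orthonormal basis of $K_{\mathbb{R}}$ (orthogonal, the first vector of norm $1$ and the others of norm $-1$), with coordinates $z_k=x_k+iy_k$, $1\le k\le b_-$, on $K_{\mathbb{C}}$. Put $\partial_k=\frac12(\partial_{x_k}-i\partial_{y_k})$, $\partial_{\overline{k}}=\frac12(\partial_{x_k}+i\partial_{y_k})$, and $$D^{*}=\sum_k y_k\partial_k,\quad \overline{D^{*}}=\sum_k y_k\partial_{\overline{k}},\quad \Delta_{K_{\mathbb{C}}}^{h}=\partial_1^2-\sum_{k=2}^{b_-}\partial_k^2,\quad \Delta_{K_{\mathbb{C}}}^{\overline{h}}=\partial_{\overline{1}}^2-\sum_{k=2}^{b_-}\partial_{\overline{k}}^2.$$ These do not depend on the orthonormal basis. Powers of $Y^2$ in operator expressions denote multiplication operators, and products denote composition. $\overline{R_0^{(b_-)}}$ is the complex conjugate operator of $R_0^{(b_-)}$. *)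

theory Defs
  imports "HOL-Analysis.Analysis"
begin


text \<open>
  The space \<open>V\<close> is a type of class \<open>euclidean_space\<close>. Its inner product only supplies the usual
  topology of a finite-dimensional real vector space; the geometry is given by a separate
  bilinear form \<open>B\<close>. Bases are indexed from 1, with the vectors of norm 1 first.
\<close>

definition orthonormal_basis ::
    "('v::real_vector \<Rightarrow> 'v \<Rightarrow> real) \<Rightarrow> 'v set \<Rightarrow> nat \<Rightarrow> nat \<Rightarrow> (nat \<Rightarrow> 'v) \<Rightarrow> bool" where
  "orthonormal_basis B S p q e \<longleftrightarrow>
     span (e ` {1..p + q}) = S \<and>
     (\<forall>j\<in>{1..p + q}. \<forall>k\<in>{1..p + q}.
        B (e j) (e k) = (if j = k then (if k \<le> p then 1 else - 1) else 0))"

definition quadratic_space :: "('v::real_vector \<Rightarrow> 'v \<Rightarrow> real) \<Rightarrow> nat \<Rightarrow> nat \<Rightarrow> bool" where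
  "quadratic_space B p q \<longleftrightarrow>
     bilinear B \<and> (\<forall>x y. B x y = B y x) \<and> (\<forall>x. (\<forall>y. B x y = 0) \<longrightarrow> x = 0) \<and>
     (\<exists>e. orthonormal_basis B UNIV p q e)"

text \<open>A pair \<open>(X, Y)\<close> stands for the vector \<open>X + iY\<close> of the complexification.\<close>

type_synonym 'v cvec = "'v \<times> 'v"

definition cscale :: "complex \<Rightarrow> 'v::real_vector cvec \<Rightarrow> 'v cvec" where
  "cscale c Z = (Re c *\<^sub>R fst Z - Im c *\<^sub>R snd Z, Re c *\<^sub>R snd Z + Im c *\<^sub>R fst Z)"

definition cconj :: "'v::real_vector cvec \<Rightarrow> 'v cvec" where
  "cconj Z = (fst Z, - snd Z)"

definition cvec_of :: "'v::real_vector \<Rightarrow> 'v cvec" where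
  "cvec_of x = (x, 0)"

definition cform :: "('v::real_vector \<Rightarrow> 'v \<Rightarrow> real) \<Rightarrow> 'v cvec \<Rightarrow> 'v cvec \<Rightarrow> complex" where
  "cform B Z W = Complex (B (fst Z) (fst W) - B (snd Z) (snd W))
                         (B (fst Z) (snd W) + B (snd Z) (fst W))"

abbreviation cmap :: "('v \<Rightarrow> 'v) \<Rightarrow> 'v cvec \<Rightarrow> 'v cvec" where
  "cmap M \<equiv> map_prod M M"



text \<open>
  For symmetric \<open>B\<close> the number \<open>cform B Z (cconj Z)\<close> is real, so taking its real part loses nothing.
  The component \<open>P\<^sup>+\<close> will be an element of \<open>components (Pset B)\<close>.
\<close>

definition Pset :: "('v::real_vector \<Rightarrow> 'v \<Rightarrow> real) \<Rightarrow> 'v cvec set" where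
  "Pset B = {Z. cform B Z Z = 0 \<and> 0 < Re (cform B Z (cconj Z))}"

definition KR :: "('v::real_vector \<Rightarrow> 'v \<Rightarrow> real) \<Rightarrow> 'v \<Rightarrow> 'v \<Rightarrow> 'v set" where
  "KR B z \<zeta> = {x. B x z = 0 \<and> B x \<zeta> = 0}"

definition ZV :: "('v::real_vector \<Rightarrow> 'v \<Rightarrow> real) \<Rightarrow> 'v \<Rightarrow> 'v \<Rightarrow> 'v cvec \<Rightarrow> 'v cvec" where
  "ZV B z \<zeta> Z =
     Z + cvec_of \<zeta> - cscale ((cform B Z Z + complex_of_real (B \<zeta> \<zeta>)) / 2) (cvec_of z)"

definition pos_cone ::
    "('v::real_vector \<Rightarrow> 'v \<Rightarrow> real) \<Rightarrow> 'v \<Rightarrow> 'v \<Rightarrow> 'v cvec set \<Rightarrow> 'v set" where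
  "pos_cone B z \<zeta> Pp =
     {Y \<in> KR B z \<zeta>. 0 < B Y Y \<and> (\<exists>X\<in>KR B z \<zeta>. ZV B z \<zeta> (X, Y) \<in> Pp)}"

definition tube ::
    "('v::real_vector \<Rightarrow> 'v \<Rightarrow> real) \<Rightarrow> 'v \<Rightarrow> 'v \<Rightarrow> 'v cvec set \<Rightarrow> 'v cvec set" where
  "tube B z \<zeta> Pp = KR B z \<zeta> \<times> pos_cone B z \<zeta> Pp"

definition Oplus :: "('v::real_vector \<Rightarrow> 'v \<Rightarrow> real) \<Rightarrow> 'v cvec set \<Rightarrow> ('v \<Rightarrow> 'v) set" where
  "Oplus B Pp =
     {M. linear M \<and> bij M \<and> (\<forall>x y. B (M x) (M y) = B x y) \<and> cmap M ` Pp = Pp}"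

text \<open>
  The pair \<open>(MZ, J(M,Z))\<close>. It is unique because every \<open>ZV B z \<zeta> W\<close> with \<open>W\<close> in the tube domain
  pairs to 1 with \<open>z\<close>.
\<close>

definition act_pair ::
    "('v::real_vector \<Rightarrow> 'v \<Rightarrow> real) \<Rightarrow> 'v \<Rightarrow> 'v \<Rightarrow> 'v cvec set \<Rightarrow> ('v \<Rightarrow> 'v) \<Rightarrow> 'v cvec
       \<Rightarrow> 'v cvec \<times> complex" where
  "act_pair B z \<zeta> Pp M Z =
     (THE (W, j). W \<in> tube B z \<zeta> Pp \<and> j \<noteq> 0 \<and>
        cmap M (ZV B z \<zeta> Z) = cscale j (ZV B z \<zeta> W))"

definition act ::
    "('v::real_vector \<Rightarrow> 'v \<Rightarrow> real) \<Rightarrow> 'v \<Rightarrow> 'v \<Rightarrow> 'v cvec set \<Rightarrow> ('v \<Rightarrow> 'v) \<Rightarrow> 'v cvec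
       \<Rightarrow> 'v cvec" where
  "act B z \<zeta> Pp M Z = fst (act_pair B z \<zeta> Pp M Z)"

definition autJ ::
    "('v::real_vector \<Rightarrow> 'v \<Rightarrow> real) \<Rightarrow> 'v \<Rightarrow> 'v \<Rightarrow> 'v cvec set \<Rightarrow> ('v \<Rightarrow> 'v) \<Rightarrow> 'v cvec
       \<Rightarrow> complex" where
  "autJ B z \<zeta> Pp M Z = snd (act_pair B z \<zeta> Pp M Z)"

definition slash ::
    "('v::real_vector \<Rightarrow> 'v \<Rightarrow> real) \<Rightarrow> 'v \<Rightarrow> 'v \<Rightarrow> 'v cvec set \<Rightarrow> int \<Rightarrow> ('v \<Rightarrow> 'v)
       \<Rightarrow> ('v cvec \<Rightarrow> complex) \<Rightarrow> 'v cvec \<Rightarrow> complex" where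
  "slash B z \<zeta> Pp m M F Z = autJ B z \<zeta> Pp M Z powi (- m) * F (act B z \<zeta> Pp M Z)"



text \<open>
  Functions on the tube domain are total functions on \<open>'v cvec\<close> whose values outside it are
  irrelevant. The domain is open only relative to the complexification of \<open>KR B z \<zeta>\<close>, so
  differentiability is taken within the domain. This determines the derivatives only on tangent
  directions, and the witnesses may be extended arbitrarily to the other directions.
\<close>

definition C2_on :: "'a::real_normed_vector set \<Rightarrow> ('a \<Rightarrow> 'b::real_normed_vector) \<Rightarrow> bool" where
  "C2_on U F \<longleftrightarrow>
     (\<exists>(F' :: 'a \<Rightarrow> 'a \<Rightarrow>\<^sub>L 'b) (F'' :: 'a \<Rightarrow> 'a \<Rightarrow>\<^sub>L 'a \<Rightarrow>\<^sub>L 'b).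
        (\<forall>Z\<in>U. (F has_derivative blinfun_apply (F' Z)) (at Z within U)) \<and>
        (\<forall>Z\<in>U. (F' has_derivative blinfun_apply (F'' Z)) (at Z within U)) \<and>
        continuous_on U F'')"

definition ddir :: "'v::real_vector cvec \<Rightarrow> ('v cvec \<Rightarrow> complex) \<Rightarrow> 'v cvec \<Rightarrow> complex" where
  "ddir u F Z = vector_derivative (\<lambda>t::real. F (Z + t *\<^sub>R u)) (at 0)"

text \<open>
  In the following, \<open>e\<close> is the chosen orthonormal basis of \<open>KR B z \<zeta>\<close>, so that \<open>ddir (e k, 0)\<close> and
  \<open>ddir (0, e k)\<close> are the partial derivatives in \<open>x\<^sub>k\<close> and \<open>y\<^sub>k\<close>; \<open>b\<close> stands for \<open>b\<^sub>-\<close>, the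
  dimension of \<open>KR B z \<zeta>\<close>.
\<close>

definition dz :: "(nat \<Rightarrow> 'v::real_vector) \<Rightarrow> nat \<Rightarrow> ('v cvec \<Rightarrow> complex) \<Rightarrow> 'v cvec \<Rightarrow> complex" where
  "dz e k F Z = (ddir (e k, 0) F Z - \<i> * ddir (0, e k) F Z) / 2"

definition dzbar ::
    "(nat \<Rightarrow> 'v::real_vector) \<Rightarrow> nat \<Rightarrow> ('v cvec \<Rightarrow> complex) \<Rightarrow> 'v cvec \<Rightarrow> complex" where
  "dzbar e k F Z = (ddir (e k, 0) F Z + \<i> * ddir (0, e k) F Z) / 2"

definition ycoord :: "(nat \<Rightarrow> 'v::real_vector) \<Rightarrow> nat \<Rightarrow> nat \<Rightarrow> 'v cvec \<Rightarrow> real" where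
  "ycoord e b k Z = representation (e ` {1..b}) (snd Z) (e k)"

definition Dstar ::
    "(nat \<Rightarrow> 'v::real_vector) \<Rightarrow> nat \<Rightarrow> ('v cvec \<Rightarrow> complex) \<Rightarrow> 'v cvec \<Rightarrow> complex" where
  "Dstar e b F Z = (\<Sum>k=1..b. complex_of_real (ycoord e b k Z) * dz e k F Z)"

definition Dstarbar ::
    "(nat \<Rightarrow> 'v::real_vector) \<Rightarrow> nat \<Rightarrow> ('v cvec \<Rightarrow> complex) \<Rightarrow> 'v cvec \<Rightarrow> complex" where
  "Dstarbar e b F Z = (\<Sum>k=1..b. complex_of_real (ycoord e b k Z) * dzbar e k F Z)"

definition Deltah ::
    "(nat \<Rightarrow> 'v::real_vector) \<Rightarrow> nat \<Rightarrow> ('v cvec \<Rightarrow> complex) \<Rightarrow> 'v cvec \<Rightarrow> complex" where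
  "Deltah e b F Z = dz e 1 (dz e 1 F) Z - (\<Sum>k=2..b. dz e k (dz e k F) Z)"

definition Deltahbar ::
    "(nat \<Rightarrow> 'v::real_vector) \<Rightarrow> nat \<Rightarrow> ('v cvec \<Rightarrow> complex) \<Rightarrow> 'v cvec \<Rightarrow> complex" where
  "Deltahbar e b F Z = dzbar e 1 (dzbar e 1 F) Z - (\<Sum>k=2..b. dzbar e k (dzbar e k F) Z)"

definition Ysq :: "('v::real_vector \<Rightarrow> 'v \<Rightarrow> real) \<Rightarrow> 'v cvec \<Rightarrow> real" where
  "Ysq B Z = B (snd Z) (snd Z)"

definition Ypow ::
    "('v::real_vector \<Rightarrow> 'v \<Rightarrow> real) \<Rightarrow> real \<Rightarrow> ('v cvec \<Rightarrow> complex) \<Rightarrow> 'v cvec \<Rightarrow> complex" where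
  "Ypow B s F Z = complex_of_real (Ysq B Z powr s) * F Z"

definition Rop ::
    "('v::real_vector \<Rightarrow> 'v \<Rightarrow> real) \<Rightarrow> (nat \<Rightarrow> 'v) \<Rightarrow> nat \<Rightarrow> int
       \<Rightarrow> ('v cvec \<Rightarrow> complex) \<Rightarrow> 'v cvec \<Rightarrow> complex" where
  "Rop B e b m F =
     Ypow B (real b / 2 - real_of_int m - 1)
       (Deltah e b (Ypow B (real_of_int m + 1 - real b / 2) F))"

definition conj_op ::
    "(('a \<Rightarrow> complex) \<Rightarrow> 'a \<Rightarrow> complex) \<Rightarrow> ('a \<Rightarrow> complex) \<Rightarrow> 'a \<Rightarrow> complex" where
  "conj_op T F Z = cnj (T (\<lambda>W. cnj (F W)) Z)"

definition Lop ::
    "('v::real_vector \<Rightarrow> 'v \<Rightarrow> real) \<Rightarrow> (nat \<Rightarrow> 'v) \<Rightarrow> nat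
       \<Rightarrow> ('v cvec \<Rightarrow> complex) \<Rightarrow> 'v cvec \<Rightarrow> complex" where
  "Lop B e b F = Ypow B 2 (conj_op (Rop B e b 0) F)"

end

theory Submission
  imports Defs
begin

text \<open>
  In coordinates with respect to \<open>e\<close>, the action of \<open>M\<close> is \<open>Z \<mapsto> (N\<^sub>j / J)\<^sub>j\<close> up to signs, where
  \<open>N\<^sub>j\<close> and \<open>J\<close> are of the form \<open>q\<^sub>w(Z) = (Z\<^sub>V, w)\<close> with \<open>w = M\<^sup>-\<^sup>1 e\<^sub>j\<close> and \<open>w = M\<^sup>-\<^sup>1 z\<close>. These
  polynomials satisfy \<open>\<langle>\<nabla>q\<^sub>w, \<nabla>q\<^sub>v\<rangle> = (w, v) - (z, w) q\<^sub>v - (z, v) q\<^sub>w\<close> and \<open>\<Delta>q\<^sub>w = - b (z, w)\<close>, which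
  makes the action holomorphic and conformal with factor \<open>J\<^sup>-\<^sup>2\<close> and expresses the Laplacians of its
  components through \<open>\<nabla>log J\<close>.

  With \<open>\<lambda> = \<nabla>log Y\<^sup>2\<close> and \<open>s = m + 1 - b/2\<close> the operator is
  \<open>R\<^sub>m F = \<Delta>F + 2 s \<langle>\<lambda>, \<nabla>F\<rangle> + m s \<langle>\<lambda>, \<lambda>\<rangle> F\<close>. Since \<open>Y\<^sup>2(MZ) |J|\<^sup>2 = Y\<^sup>2(Z)\<close>, the action pulls
  \<open>\<lambda>\<close> back to \<open>\<lambda> - \<nabla>log J\<close>, and the terms coming from the derivatives of \<open>J\<^sup>-\<^sup>m\<close> and from the
  second derivatives of the action complete the two inner products to this shifted gradient.
\<close>

text \<open>Keeps the \<open>1\<close> in \<open>e 1\<close> and \<open>{1..b}\<close> from becoming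
  \<open>Suc 0\<close>, so that the rules about the basis still match.\<close>

declare One_nat_def [simp del]

section \<open>Complex scalars on the complexification\<close>

lemma cscale_cscale: "cscale c (cscale d Z) = cscale (c * d) Z"
  by (simp add: cscale_def algebra_simps)

lemma cscale_one: "cscale 1 Z = Z"
  by (simp add: cscale_def)

lemma bounded_linear_cscale:
  fixes Z :: "'v::euclidean_space cvec"
  shows "bounded_linear (\<lambda>c. cscale c Z)"
  unfolding linear_conv_bounded_linear[symmetric]
  by (rule linearI) (simp_all add: cscale_def algebra_simps scaleR_prod_def)

text \<open>The norm of \<open>e k\<close> for a basis of signature (1, b - 1). It is its own
  inverse, so the same factor serves for the form on vectors and for the dual form on
  gradients.\<close>

definition basis_sign :: "nat \<Rightarrow> real" where
  "basis_sign k = (if k = 1 then 1 else - 1)"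

lemma basis_sign_sq [simp]: "basis_sign k * basis_sign k = 1"
  by (simp add: basis_sign_def)

section \<open>Lorentzian linear algebra on \<open>K\<close>\<close>

locale tube_domain =
  fixes B :: "'v::euclidean_space \<Rightarrow> 'v \<Rightarrow> real"
    and b :: nat and z \<zeta> :: 'v and Pp :: "'v cvec set" and e :: "nat \<Rightarrow> 'v"
  assumes b_pos: "1 \<le> b"
    and bil: "bilinear B"
    and sym: "B x y = B y x"
    and Pp: "Pp \<in> components (Pset B)"
    and zz: "B z z = 0"
    and z_zeta: "B z \<zeta> = 1"
    and basis: "orthonormal_basis B (KR B z \<zeta>) 1 (b - 1) e"
begin

abbreviation K :: "'v set" where "K \<equiv> KR B z \<zeta>"

abbreviation U :: "'v cvec set" where "U \<equiv> tube B z \<zeta> Pp"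

lemmas B_simps = bilinear_ladd[OF bil] bilinear_radd[OF bil] bilinear_lsub[OF bil]
  bilinear_rsub[OF bil] bilinear_lmul[OF bil] bilinear_rmul[OF bil] bilinear_lneg[OF bil]
  bilinear_rneg[OF bil] bilinear_lzero[OF bil] bilinear_rzero[OF bil]

lemma B_sum_left: "B (sum f S) y = (\<Sum>i\<in>S. B (f i) y)"
proof -
  interpret linear "\<lambda>x. B x y" using bil by (simp add: bilinear_def)
  show ?thesis by (rule sum)
qed

lemma zeta_z: "B \<zeta> z = 1"
  using z_zeta sym by metis

lemma subspace_K: "subspace K"
  by (auto simp: subspace_def KR_def B_simps)

lemma e_in_K: "k \<in> {1..b} \<Longrightarrow> e k \<in> K"
  using basis span_superset[of "e ` {1..b}"] b_pos by (auto simp: orthonormal_basis_def)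

lemma span_e: "span (e ` {1..b}) = K"
  using basis b_pos by (auto simp: orthonormal_basis_def)

lemma B_e: "j \<in> {1..b} \<Longrightarrow> k \<in> {1..b} \<Longrightarrow> B (e j) (e k) = (if j = k then basis_sign k else 0)"
  using basis b_pos by (auto simp: orthonormal_basis_def basis_sign_def)

lemma B_z_e: "k \<in> {1..b} \<Longrightarrow> B z (e k) = 0" and B_e_z: "k \<in> {1..b} \<Longrightarrow> B (e k) z = 0"
  and B_zeta_e: "k \<in> {1..b} \<Longrightarrow> B \<zeta> (e k) = 0"
  using e_in_K sym by (auto simp: KR_def)

text \<open>Both sides are linear in \<open>x\<close> and agree on the basis vectors, which span
  \<open>K\<close>.\<close>

lemma K_expand:
  assumes "x \<in> K"
  shows "x = (\<Sum>k\<in>{1..b}. (basis_sign k * B x (e k)) *\<^sub>R e k)"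
proof -
  have "linear (\<lambda>x. \<Sum>k\<in>{1..b}. (basis_sign k * B x (e k)) *\<^sub>R e k)"
    by (rule linearI) (simp_all add: B_simps algebra_simps sum.distrib scaleR_right.sum)
  moreover have "y = (\<Sum>k\<in>{1..b}. (basis_sign k * B y (e k)) *\<^sub>R e k)" if "y \<in> e ` {1..b}" for y
  proof -
    from that obtain j where j: "j \<in> {1..b}" "y = e j" by blast
    have "(\<Sum>k\<in>{1..b}. (basis_sign k * B y (e k)) *\<^sub>R e k) = (\<Sum>k\<in>{1..b}. if j = k then e k else 0)"
      using j by (intro sum.cong) (auto simp: B_e)
    then show ?thesis using j by simp
  qed
  ultimately show ?thesis
    using linear_eq_on_span[of id "\<lambda>x. \<Sum>k\<in>{1..b}. (basis_sign k * B x (e k)) *\<^sub>R e k" "e ` {1..b}" x]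
      assms span_e by (auto simp: linear_id)
qed

lemma parseval:
  assumes "x \<in> K"
  shows "(\<Sum>k\<in>{1..b}. basis_sign k * B x (e k) * B y (e k)) = B x y"
proof -
  have "B x y = B (\<Sum>k\<in>{1..b}. (basis_sign k * B x (e k)) *\<^sub>R e k) y"
    using K_expand[OF assms] by simp
  also have "\<dots> = (\<Sum>k\<in>{1..b}. basis_sign k * B x (e k) * B y (e k))"
    by (simp add: B_sum_left B_simps sym[of y])
  finally show ?thesis by simp
qed

text \<open>Orthogonal projection away from the plane spanned by \<open>z\<close> and
  \<open>\<zeta>\<close>. The correction in the coefficient of \<open>z\<close> is due to
  \<open>\<zeta>\<close> having an arbitrary norm.\<close>

lemma proj_in_K: "w - B w z *\<^sub>R \<zeta> - (B w \<zeta> - B w z * B \<zeta> \<zeta>) *\<^sub>R z \<in> K"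
  by (simp add: KR_def B_simps zz z_zeta zeta_z)

text \<open>Projecting \<open>w\<close> to \<open>K\<close> does not change its products with the
  \<open>e k\<close>, so \<open>parseval\<close> applies to the projection while \<open>w'\<close>
  stays arbitrary.\<close>

lemma parseval_V:
  "(\<Sum>k\<in>{1..b}. basis_sign k * B w (e k) * B w' (e k)) =
     B w w' - B w z * B w' \<zeta> - B w' z * B w \<zeta> + B w z * B w' z * B \<zeta> \<zeta>"
proof -
  let ?x = "w - B w z *\<^sub>R \<zeta> - (B w \<zeta> - B w z * B \<zeta> \<zeta>) *\<^sub>R z"
  have "(\<Sum>k\<in>{1..b}. basis_sign k * B w (e k) * B w' (e k)) =
    (\<Sum>k\<in>{1..b}. basis_sign k * B ?x (e k) * B w' (e k))"
    by (intro sum.cong) (auto simp: B_simps B_z_e B_zeta_e)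
  also have "\<dots> = B ?x w'" by (rule parseval[OF proj_in_K])
  finally show ?thesis
    using sym[of \<zeta> w'] sym[of z w'] by (simp add: B_simps algebra_simps)
qed

lemma independent_e: "independent (e ` {1..b})" and inj_e: "inj_on e {1..b}"
proof -
  show inj: "inj_on e {1..b}"
  proof (rule inj_onI)
    fix j k assume jk: "j \<in> {1..b}" "k \<in> {1..b}" "e j = e k"
    then have "B (e j) (e k) \<noteq> 0" by (simp add: B_e basis_sign_def)
    then show "j = k" using jk B_e by metis
  qed
  show "independent (e ` {1..b})"
    unfolding dependent_finite[OF finite_imageI[OF finite_atLeastAtMost]]
  proof safe
    fix u k assume u: "(\<Sum>v\<in>e ` {1..b}. u v *\<^sub>R v) = 0" and k: "k \<in> {1..b}" "u (e k) \<noteq> 0"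
    have "0 = B (\<Sum>j\<in>{1..b}. u (e j) *\<^sub>R e j) (e k)"
      using u by (simp add: sum.reindex[OF inj] o_def B_simps)
    also have "\<dots> = (\<Sum>j\<in>{1..b}. u (e j) * B (e j) (e k))"
      by (simp add: B_sum_left B_simps)
    also have "\<dots> = (\<Sum>j\<in>{1..b}. if j = k then u (e k) * basis_sign k else 0)"
      by (intro sum.cong) (use k in \<open>auto simp: B_e\<close>)
    finally show False using k by (simp add: basis_sign_def split: if_splits)
  qed
qed

lemma ycoord_eq:
  assumes "snd Z \<in> K" and k: "k \<in> {1..b}"
  shows "ycoord e b k Z = basis_sign k * B (snd Z) (e k)"
proof -
  define r where "r = representation (e ` {1..b}) (snd Z)"
  have "(\<Sum>v\<in>e ` {1..b}. r v *\<^sub>R v) = snd Z"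
    unfolding r_def by (rule sum_representation_eq) (use assms span_e independent_e in auto)
  then have "B (snd Z) (e k) = B (\<Sum>j\<in>{1..b}. r (e j) *\<^sub>R e j) (e k)"
    by (simp add: sum.reindex[OF inj_e] o_def)
  also have "\<dots> = (\<Sum>j\<in>{1..b}. r (e j) * B (e j) (e k))"
    by (simp add: B_sum_left B_simps)
  also have "\<dots> = (\<Sum>j\<in>{1..b}. if j = k then r (e k) * basis_sign k else 0)"
    by (intro sum.cong) (use k in \<open>auto simp: B_e\<close>)
  finally have "B (snd Z) (e k) = r (e k) * basis_sign k" using k by simp
  then show ?thesis by (simp add: ycoord_def r_def algebra_simps)
qed

section \<open>The complexified form\<close>

lemma bilinear_cform: "bilinear (cform B)"
  unfolding bilinear_def
proof (intro conjI allI)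
  show "linear (cform B Z)" for Z
    by (rule linearI) (simp_all add: cform_def B_simps complex_eq_iff algebra_simps)
  show "linear (\<lambda>Z. cform B Z W)" for W
    by (rule linearI) (simp_all add: cform_def B_simps complex_eq_iff algebra_simps)
qed

lemmas cform_simps = bilinear_ladd[OF bilinear_cform] bilinear_radd[OF bilinear_cform]
  bilinear_lsub[OF bilinear_cform] bilinear_rsub[OF bilinear_cform]

lemma cform_cscale_left: "cform B (cscale c Z) W = c * cform B Z W"
  by (simp add: cform_def cscale_def complex_eq_iff B_simps algebra_simps)

lemma cform_sym: "cform B Z W = cform B W Z"
  using sym by (simp add: cform_def complex_eq_iff)

lemma cform_cscale_right: "cform B Z (cscale c W) = c * cform B Z W"
  using cform_cscale_left cform_sym by metis

lemma cform_real: "cform B (x, 0) (y, 0) = complex_of_real (B x y)"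
  by (simp add: cform_def complex_eq_iff B_simps)

lemma cform_sum_left: "cform B (sum f S) W = (\<Sum>i\<in>S. cform B (f i) W)"
proof -
  interpret linear "\<lambda>x. cform B x W" using bilinear_cform unfolding bilinear_def by blast
  show ?thesis by (rule sum)
qed

lemma bounded_bilinear_cform: "bounded_bilinear (cform B)"
  using bilinear_cform bilinear_conv_bounded_bilinear by blast

lemma bounded_bilinear_B: "bounded_bilinear B"
  using bil bilinear_conv_bounded_bilinear by blast

definition cbasis_sum :: "(nat \<Rightarrow> complex) \<Rightarrow> 'v cvec" where
  "cbasis_sum c = (\<Sum>k\<in>{1..b}. cscale (c k) (e k, 0))"

lemma K_cexpand:
  assumes "Z \<in> K \<times> K"
  shows "Z = cbasis_sum (\<lambda>k. basis_sign k * cform B Z (e k, 0))"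
proof (rule prod_eqI)
  show "fst Z = fst (cbasis_sum (\<lambda>k. basis_sign k * cform B Z (e k, 0)))"
    using K_expand[of "fst Z"] assms
    by (auto simp: cbasis_sum_def cscale_def fst_sum cform_def B_simps)
  show "snd Z = snd (cbasis_sum (\<lambda>k. basis_sign k * cform B Z (e k, 0)))"
    using K_expand[of "snd Z"] assms
    by (auto simp: cbasis_sum_def cscale_def snd_sum cform_def B_simps)
qed

lemma cparseval:
  assumes "Z \<in> K \<times> K"
  shows "(\<Sum>k\<in>{1..b}. basis_sign k * cform B Z (e k, 0) * cform B W (e k, 0)) = cform B Z W"
proof -
  have "cform B Z W = cform B (cbasis_sum (\<lambda>k. basis_sign k * cform B Z (e k, 0))) W"
    using K_cexpand[OF assms] by metis
  also have "\<dots> = (\<Sum>k\<in>{1..b}. basis_sign k * cform B Z (e k, 0) * cform B W (e k, 0))"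
    by (simp add: cbasis_sum_def cform_sum_left cform_cscale_left cform_sym[of "(_, 0)" W])
  finally show ?thesis by simp
qed

lemma cform_KK:
  assumes "Z \<in> K \<times> K"
  shows "cform B Z (z, 0) = 0" "cform B (z, 0) Z = 0" "cform B Z (\<zeta>, 0) = 0" "cform B (\<zeta>, 0) Z = 0"
  using assms sym by (auto simp: KR_def cform_def complex_eq_iff B_simps)

section \<open>The embedding of the tube domain into \<open>Pset B\<close>\<close>

lemma ZV_alt:
  "ZV B z \<zeta> Z = Z + (\<zeta>, 0) - cscale ((cform B Z Z + complex_of_real (B \<zeta> \<zeta>)) / 2) (z, 0)"
  by (simp add: ZV_def cvec_of_def)

lemma cform_ZV_e:
  assumes "k \<in> {1..b}"
  shows "cform B (ZV B z \<zeta> Z) (e k, 0) = cform B Z (e k, 0)"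
  using assms by (simp add: ZV_alt cform_simps cform_cscale_left cform_real B_z_e B_zeta_e)

lemma cform_ZV_z: "Z \<in> K \<times> K \<Longrightarrow> cform B (ZV B z \<zeta> Z) (z, 0) = 1"
  by (simp add: ZV_alt cform_simps cform_cscale_left cform_KK cform_real zeta_z zz)

lemma cform_ZV_ZV: "Z \<in> K \<times> K \<Longrightarrow> cform B (ZV B z \<zeta> Z) (ZV B z \<zeta> Z) = 0"
  by (simp add: ZV_alt cform_simps cform_cscale_left cform_cscale_right cform_KK cform_real
      zeta_z z_zeta zz)

text \<open>The coefficient of \<open>z\<close> contributes minus twice its real part, which cancels
  \<open>\<zeta>^2\<close> and \<open>X^2\<close> and doubles \<open>Y^2\<close>.\<close>

lemma cform_ZV_cconj:
  assumes "Z \<in> K \<times> K"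
  shows "cform B (ZV B z \<zeta> Z) (cconj (ZV B z \<zeta> Z)) = complex_of_real (2 * Ysq B Z)"
proof -
  define c where "c = (cform B Z Z + complex_of_real (B \<zeta> \<zeta>)) / 2"
  have 1: "cconj (ZV B z \<zeta> Z) = cconj Z + (\<zeta>, 0) - cscale (cnj c) (z, 0)"
    by (simp add: ZV_alt c_def[symmetric] cconj_def cscale_def)
  have 2: "cconj Z \<in> K \<times> K"
    using assms by (auto simp: cconj_def KR_def B_simps)
  have 3: "cform B Z (cconj Z) = B (fst Z) (fst Z) + B (snd Z) (snd Z)"
    using sym by (simp add: cform_def cconj_def B_simps complex_eq_iff)
  have 4: "Re c = (B (fst Z) (fst Z) - B (snd Z) (snd Z) + B \<zeta> \<zeta>) / 2"
    by (simp add: c_def cform_def)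
  have "cform B (ZV B z \<zeta> Z) (cconj (ZV B z \<zeta> Z)) = cform B Z (cconj Z) + B \<zeta> \<zeta> - c - cnj c"
    using assms 2
    unfolding 1 unfolding ZV_alt c_def[symmetric]
    by (simp add: cform_simps cform_cscale_left cform_cscale_right
        cform_KK cform_real zeta_z z_zeta zz)
  then show ?thesis using 4 by (simp add: 3 complex_eq_iff Ysq_def)
qed

lemma ZV_in_Pset: "Z \<in> K \<times> K \<Longrightarrow> ZV B z \<zeta> Z \<in> Pset B \<longleftrightarrow> 0 < Ysq B Z"
  by (simp add: Pset_def cform_ZV_ZV cform_ZV_cconj)

lemma continuous_on_ZV: "continuous_on S (ZV B z \<zeta>)"
proof -
  have "continuous_on S (\<lambda>Z. cscale (f Z) (z, 0))" if "continuous_on S f" for f :: "'v cvec \<Rightarrow> complex"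
    by (rule bounded_linear.continuous_on[OF bounded_linear_cscale that])
  note this [continuous_intros]
  show ?thesis
    unfolding ZV_alt
    by (intro continuous_intros bounded_bilinear.continuous_on[OF bounded_bilinear_cform]) auto
qed

lemma connected_in_Pp:
  assumes "connected T" "T \<subseteq> Pset B" "x \<in> T" "x \<in> Pp" "y \<in> T"
  shows "y \<in> Pp"
  using components_maximal[OF Pp assms(1,2)] assms(3-5) by auto

text \<open>\<open>ZV\<close> is continuous and maps a connected set with \<open>Y^2 > 0\<close> to
  a connected subset of \<open>Pset B\<close>, which cannot leave the component
  \<open>Pp\<close>.\<close>

lemma ZV_path:
  assumes "connected T" "T \<subseteq> K \<times> K" "\<And>W. W \<in> T \<Longrightarrow> 0 < Ysq B W" "Z \<in> T" "ZV B z \<zeta> Z \<in> Pp" "W \<in> T"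
  shows "ZV B z \<zeta> W \<in> Pp"
  by (rule connected_in_Pp[of "ZV B z \<zeta> ` T" "ZV B z \<zeta> Z"])
    (use assms ZV_in_Pset in \<open>auto intro!: connected_continuous_image continuous_on_ZV\<close>)

text \<open>\<open>pos_cone\<close> asks for a single real part \<open>X\<close>. The slice with
  fixed imaginary part is convex, so \<open>ZV_path\<close> carries membership in \<open>Pp\<close>
  to every other real part.\<close>

lemma tube_iff: "Z \<in> U \<longleftrightarrow> Z \<in> K \<times> K \<and> 0 < Ysq B Z \<and> ZV B z \<zeta> Z \<in> Pp"
proof
  assume "Z \<in> U"
  then obtain X where X: "Z \<in> K \<times> K" "0 < Ysq B Z" "X \<in> K" "ZV B z \<zeta> (X, snd Z) \<in> Pp"
    by (auto simp: tube_def pos_cone_def Ysq_def)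
  have "ZV B z \<zeta> Z \<in> Pp"
    by (rule ZV_path[of "K \<times> {snd Z}" "(X, snd Z)"])
      (use X in \<open>auto simp: Ysq_def subspace_K subspace_imp_convex convex_connected connected_Times\<close>)
  then show "Z \<in> K \<times> K \<and> 0 < Ysq B Z \<and> ZV B z \<zeta> Z \<in> Pp" using X by auto
qed (auto simp: tube_def pos_cone_def Ysq_def)

lemma tube_subset: "U \<subseteq> K \<times> K"
  using tube_iff by auto

lemma subspace_KK: "subspace (K \<times> K)"
  using subspace_K subspace_K by (rule subspace_Times)

text \<open>Openness of the tube relative to \<open>K \<times> K\<close>, in the form that
  directional derivatives require: \<open>Y^2\<close> stays positive on a short segment, and
  \<open>ZV_path\<close> keeps the segment in the right component.\<close>

lemma eventually_tube:
  assumes Z: "Z \<in> U" and u: "u \<in> K \<times> K"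
  shows "\<forall>\<^sub>F t in nhds 0. Z + t *\<^sub>R u \<in> U"
proof -
  have "((\<lambda>t. B (snd (Z + t *\<^sub>R u)) (snd (Z + t *\<^sub>R u))) \<longlongrightarrow> B (snd (Z + 0 *\<^sub>R u)) (snd (Z + 0 *\<^sub>R u))) (nhds 0)"
    by (intro bounded_bilinear.tendsto[OF bounded_bilinear_B] tendsto_intros filterlim_ident)
  then have "\<forall>\<^sub>F t in nhds 0. 0 < Ysq B (Z + t *\<^sub>R u)"
    using Z by (intro order_tendstoD(1)) (auto simp: Ysq_def tube_iff)
  then obtain d where d: "d > 0" "\<And>t. dist t 0 < d \<Longrightarrow> 0 < Ysq B (Z + t *\<^sub>R u)"
    unfolding eventually_nhds_metric by auto
  have ZK: "Z + t *\<^sub>R u \<in> K \<times> K" for t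
    using subspace_add[OF subspace_KK _ subspace_scale[OF subspace_KK u]] Z tube_subset by blast
  have "Z + t *\<^sub>R u \<in> U" if t: "dist t 0 < d" for t
  proof -
    have "ZV B z \<zeta> (Z + t *\<^sub>R u) \<in> Pp"
    proof (rule ZV_path[of "(\<lambda>t. Z + t *\<^sub>R u) ` ball 0 d" Z])
      show "connected ((\<lambda>t. Z + t *\<^sub>R u) ` ball 0 d)"
        by (intro connected_continuous_image continuous_intros connected_ball)
      show "Z \<in> (\<lambda>t. Z + t *\<^sub>R u) ` ball 0 d" using d by (intro image_eqI[of _ _ 0]) auto
      show "(\<lambda>t. Z + t *\<^sub>R u) ` ball 0 d \<subseteq> K \<times> K" using ZK by blast
    qed (use d t Z in \<open>auto simp: tube_iff dist_commute\<close>)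
    then show ?thesis using d t ZK by (simp add: tube_iff)
  qed
  then show ?thesis using d unfolding eventually_nhds_metric by auto
qed

section \<open>The action on the tube domain\<close>

lemma Pset_cscale:
  assumes "c \<noteq> 0"
  shows "cscale c W \<in> Pset B \<longleftrightarrow> W \<in> Pset B"
proof -
  have "cconj (cscale c W) = cscale (cnj c) (cconj W)"
    by (simp add: cconj_def cscale_def)
  then have "cform B (cscale c W) (cconj (cscale c W)) = c * cnj c * cform B W (cconj W)"
    by (simp add: cform_cscale_left cform_cscale_right)
  then have "cform B (cscale c W) (cconj (cscale c W)) = of_real ((cmod c)\<^sup>2) * cform B W (cconj W)"
    by (simp add: complex_norm_square[symmetric])
  then show ?thesis
    using assms by (simp add: Pset_def cform_cscale_left cform_cscale_right zero_less_mult_iff)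
qed

lemma Pp_subset: "Pp \<subseteq> Pset B"
  using Pp in_components_subset by auto

text \<open>The punctured complex plane is connected, so all non-zero multiples of \<open>W\<close>
  lie in one component.\<close>

lemma Pp_cscale:
  assumes "c \<noteq> 0" "W \<in> Pp"
  shows "cscale c W \<in> Pp"
proof (rule connected_in_Pp[of "(\<lambda>c. cscale c W) ` (- {0})" W])
  have "connected (- {0::complex})"
    by (rule connected_punctured_universe) simp
  then show "connected ((\<lambda>c. cscale c W) ` (- {0}))"
    by (intro connected_continuous_image)
      (auto intro: bounded_linear.continuous_on[OF bounded_linear_cscale] continuous_intros)
  show "(\<lambda>c. cscale c W) ` (- {0}) \<subseteq> Pset B"
    using Pset_cscale Pp_subset assms(2) by blast
  show "W \<in> (\<lambda>c. cscale c W) ` (- {0})"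
    by (rule image_eqI[of _ _ 1]) (auto simp: cscale_one)
qed (use assms in auto)

text \<open>If \<open>(W, z) = 0\<close>, then the real and imaginary parts of \<open>W\<close> span a positive definite plane in
  \<open>z\<^sup>\<bottom>\<close>, and a vector of this plane orthogonal to \<open>e\<^sub>1\<close> contradicts the signature.\<close>

lemma cform_z_nonzero:
  assumes "W \<in> Pset B"
  shows "cform B W (z, 0) \<noteq> 0"
proof
  assume W0: "cform B W (z, 0) = 0"
  define A C where "A = fst W" and "C = snd W"
  have AC: "B A z = 0" "B C z = 0"
    using W0 by (auto simp: cform_def complex_eq_iff B_simps A_def C_def)
  have P: "B A A = B C C" "B A C = 0" "B A A > 0"
    using assms sym[of A C]
    by (auto simp: Pset_def cform_def cconj_def complex_eq_iff B_simps A_def C_def)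
  define x where "x = B C (e 1) *\<^sub>R A - B A (e 1) *\<^sub>R C"
  have norm: "B w w = (B w (e 1))\<^sup>2 - (\<Sum>k\<in>{2..b}. (B w (e k))\<^sup>2)" if "B w z = 0" for w
  proof -
    have "{1..b} = insert 1 {2..b}" using b_pos by auto
    then show ?thesis
      using parseval_V[of w w] that by (simp add: basis_sign_def power2_eq_square sum_negf)
  qed
  have "B x (e 1) = 0" "B x z = 0" by (simp_all add: x_def B_simps AC)
  then have "B x x \<le> 0" using norm[of x] by (simp add: sum_nonneg)
  moreover have "B x x = ((B C (e 1))\<^sup>2 + (B A (e 1))\<^sup>2) * B A A"
    using P sym[of A C] by (simp add: x_def B_simps power2_eq_square algebra_simps)
  ultimately have "(B C (e 1))\<^sup>2 + (B A (e 1))\<^sup>2 \<le> 0"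
    using P by (simp add: mult_le_0_iff)
  then have "B A (e 1) = 0" by (simp add: sum_power2_le_zero_iff)
  then have "B A A \<le> 0" using norm[of A] AC by (simp add: sum_nonneg)
  then show False using P by simp
qed

text \<open>Write P = W + \<zeta> + d z. Orthogonality of W to \<open>\<zeta>\<close> determines d
  as the product of P - \<zeta> with \<open>\<zeta>\<close>, and isotropy of P forces d to be the
  coefficient used in \<open>ZV\<close>.\<close>

lemma ZV_surj:
  assumes "cform B P P = 0" "cform B P (z, 0) = 1"
  shows "\<exists>W\<in>K \<times> K. P = ZV B z \<zeta> W"
proof -
  obtain P1 P2 where P: "P = (P1, P2)" by fastforce
  have Pz: "B P1 z = 1" "B P2 z = 0" "B z P1 = 1" "B z P2 = 0"
    using assms(2) sym[of z P1] sym[of z P2] by (auto simp: P cform_def complex_eq_iff B_simps)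
  have PP: "B P1 P1 = B P2 P2" "B P1 P2 = 0" "B P2 P1 = 0"
    using assms(1) sym[of P1 P2] by (auto simp: P cform_def complex_eq_iff)
  define d1 where "d1 = B P1 \<zeta> - B \<zeta> \<zeta>"
  define d2 where "d2 = B P2 \<zeta>"
  define W where "W = (P1 - \<zeta> - d1 *\<^sub>R z, P2 - d2 *\<^sub>R z)"
  have "W \<in> K \<times> K"
    by (auto simp: W_def KR_def B_simps Pz zeta_z z_zeta zz d1_def d2_def)
  moreover have "(cform B W W + complex_of_real (B \<zeta> \<zeta>)) / 2 = - Complex d1 d2"
    using sym[of \<zeta> P1] sym[of \<zeta> P2]
    by (simp add: W_def cform_def complex_eq_iff B_simps Pz PP zeta_z z_zeta zz d1_def d2_def)
  then have "P = ZV B z \<zeta> W"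
    by (simp add: ZV_alt W_def cscale_def P)
  ultimately show ?thesis by blast
qed

text \<open>Pairing \<open>X\<close> with \<open>z\<close> reads off \<open>j\<close>, and pairing
  with the \<open>e k\<close> reads off the coordinates of \<open>W\<close>. This gives both
  uniqueness in \<open>act_pair\<close> and explicit formulas.\<close>

lemma act_pair_char:
  assumes W: "W \<in> K \<times> K" and eq: "X = cscale j (ZV B z \<zeta> W)" and j: "j \<noteq> 0"
  shows "j = cform B X (z, 0)"
    and "W = cbasis_sum (\<lambda>k. basis_sign k * cform B X (e k, 0) / cform B X (z, 0))"
proof -
  show 1: "j = cform B X (z, 0)"
    using W by (simp add: eq cform_cscale_left cform_ZV_z)
  have "cbasis_sum (\<lambda>k. basis_sign k * cform B X (e k, 0) / cform B X (z, 0)) =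
    cbasis_sum (\<lambda>k. basis_sign k * cform B W (e k, 0))"
    unfolding cbasis_sum_def 1[symmetric]
    by (intro sum.cong) (use j in \<open>auto simp: eq cform_cscale_left cform_ZV_e\<close>)
  then show "W = cbasis_sum (\<lambda>k. basis_sign k * cform B X (e k, 0) / cform B X (z, 0))"
    using K_cexpand[OF W] by metis
qed

text \<open>Resolves the definite description. For existence, \<open>M\<close> preserves
  \<open>Pp\<close>, \<open>cform_z_nonzero\<close> allows the image to be scaled to have product 1
  with \<open>z\<close>, and \<open>ZV_surj\<close> gives the point.\<close>

lemma act_pair_props:
  assumes M: "M \<in> Oplus B Pp" and Z: "Z \<in> U"
  defines "X \<equiv> cmap M (ZV B z \<zeta> Z)"
  shows "act B z \<zeta> Pp M Z \<in> U" and "autJ B z \<zeta> Pp M Z \<noteq> 0"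
    and "X = cscale (autJ B z \<zeta> Pp M Z) (ZV B z \<zeta> (act B z \<zeta> Pp M Z))"
    and "autJ B z \<zeta> Pp M Z = cform B X (z, 0)"
    and "act B z \<zeta> Pp M Z =
      cbasis_sum (\<lambda>k. basis_sign k * cform B X (e k, 0) / cform B X (z, 0))"
proof -
  have "cmap M ` Pp = Pp" using M by (simp add: Oplus_def)
  moreover have "ZV B z \<zeta> Z \<in> Pp" using Z by (simp add: tube_iff)
  ultimately have XP: "X \<in> Pp" unfolding X_def by blast
  define j where "j = cform B X (z, 0)"
  have j0: "j \<noteq> 0" unfolding j_def by (rule cform_z_nonzero[OF subsetD[OF Pp_subset XP]])
  then have P: "cscale (1 / j) X \<in> Pp" using Pp_cscale[OF _ XP] by simp
  obtain W where W: "W \<in> K \<times> K" "cscale (1 / j) X = ZV B z \<zeta> W"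
  proof -
    have "cform B (cscale (1 / j) X) (cscale (1 / j) X) = 0"
      using P Pp_subset by (auto simp: Pset_def)
    moreover have "cform B (cscale (1 / j) X) (z, 0) = 1"
      using j0 by (simp add: cform_cscale_left j_def[symmetric])
    ultimately show ?thesis using ZV_surj that by blast
  qed
  have XW: "X = cscale j (ZV B z \<zeta> W)"
    using j0 by (simp add: W(2)[symmetric] cscale_cscale cscale_one)
  have WU: "W \<in> U" using W P Pp_subset ZV_in_Pset[OF W(1)] unfolding tube_iff W(2) by blast
  have "act_pair B z \<zeta> Pp M Z = (W, j)"
    unfolding act_pair_def X_def[symmetric]
  proof (rule the_equality)
    fix p assume p: "case p of (W, j) \<Rightarrow> W \<in> U \<and> j \<noteq> 0 \<and> X = cscale j (ZV B z \<zeta> W)"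
    obtain W' j' where Wj: "p = (W', j')" by fastforce
    have p': "W' \<in> K \<times> K" "X = cscale j' (ZV B z \<zeta> W')" "j' \<noteq> 0"
      using p tube_subset unfolding Wj by blast+
    have "W' = W"
      by (rule trans[OF act_pair_char(2)[OF p'] act_pair_char(2)[OF W(1) XW j0, symmetric]])
    moreover have "j' = j"
      by (rule trans[OF act_pair_char(1)[OF p'] act_pair_char(1)[OF W(1) XW j0, symmetric]])
    ultimately show "p = (W, j)" unfolding Wj by blast
  qed (unfold prod.case, intro conjI WU j0 XW)
  then have aW: "act B z \<zeta> Pp M Z = W" and aj: "autJ B z \<zeta> Pp M Z = j"
    by (simp_all add: act_def autJ_def)
  show "act B z \<zeta> Pp M Z \<in> U" "autJ B z \<zeta> Pp M Z \<noteq> 0"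
    unfolding aW aj by (fact WU, fact j0)
  show "X = cscale (autJ B z \<zeta> Pp M Z) (ZV B z \<zeta> (act B z \<zeta> Pp M Z))"
    unfolding aW aj by (fact XW)
  show "autJ B z \<zeta> Pp M Z = cform B X (z, 0)"
    unfolding aj by (fact j_def)
  show "act B z \<zeta> Pp M Z =
      cbasis_sum (\<lambda>k. basis_sign k * cform B X (e k, 0) / cform B X (z, 0))"
    unfolding aW by (rule act_pair_char(2)[OF W(1) XW j0])
qed

text \<open>By \<open>cform_ZV_cconj\<close>, \<open>2 * Ysq\<close> is the Hermitian norm of
  \<open>ZV\<close>. A real isometry preserves this norm, and scaling by \<open>j\<close> multiplies
  it by \<open>|j|^2\<close>.\<close>

lemma Ysq_act:
  assumes M: "M \<in> Oplus B Pp" and Z: "Z \<in> U"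
  shows "complex_of_real (Ysq B (act B z \<zeta> Pp M Z)) * (autJ B z \<zeta> Pp M Z * cnj (autJ B z \<zeta> Pp M Z)) =
    complex_of_real (Ysq B Z)"
proof -
  note p = act_pair_props[OF M Z]
  define j where "j = autJ B z \<zeta> Pp M Z"
  define W where "W = act B z \<zeta> Pp M Z"
  have W: "W \<in> K \<times> K" and ZK: "Z \<in> K \<times> K"
    using p(1) Z tube_subset by (auto simp: W_def)
  have lin: "linear M" and iso: "\<And>x y. B (M x) (M y) = B x y"
    using M by (auto simp: Oplus_def)
  have "cform B (cmap M Z') (cconj (cmap M Z')) = cform B Z' (cconj Z')" for Z'
    by (simp add: cform_def cconj_def iso B_simps)
  then have "of_real (2 * Ysq B Z) = cform B (cmap M (ZV B z \<zeta> Z)) (cconj (cmap M (ZV B z \<zeta> Z)))"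
    using cform_ZV_cconj[OF ZK] by simp
  also have "\<dots> = cform B (cscale j (ZV B z \<zeta> W)) (cconj (cscale j (ZV B z \<zeta> W)))"
    using p(3) by (simp add: j_def W_def)
  also have "\<dots> = j * cnj j * of_real (2 * Ysq B W)"
  proof -
    have "cconj (cscale j (ZV B z \<zeta> W)) = cscale (cnj j) (cconj (ZV B z \<zeta> W))"
      by (simp add: cconj_def cscale_def)
    then show ?thesis
      by (simp add: cform_cscale_left cform_cscale_right cform_ZV_cconj[OF W])
  qed
  finally show ?thesis by (simp add: j_def W_def algebra_simps)
qed

end

section \<open>Wirtinger calculus on the tube domain\<close>

lemma differentiable_on_cong:
  assumes "f differentiable_on S" "\<And>x. x \<in> S \<Longrightarrow> g x = f x"
  shows "g differentiable_on S"
  unfolding differentiable_on_def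
proof
  fix x assume x: "x \<in> S"
  then obtain D where "(f has_derivative D) (at x within S)"
    using assms(1) by (auto simp: differentiable_on_def differentiable_def)
  then have "(g has_derivative D) (at x within S)"
    using assms(2) x by (auto intro: has_derivative_transform[of x S g f])
  then show "g differentiable (at x within S)" by (auto simp: differentiable_def)
qed

lemma differentiable_on_cnj [derivative_intros]:
  "f differentiable_on S \<Longrightarrow> (\<lambda>x. cnj (f x)) differentiable_on S"
  by (auto simp: differentiable_on_def differentiable_def
      intro: bounded_linear.has_derivative[OF bounded_linear_cnj])

lemma differentiable_on_finite_sum [derivative_intros]:
  assumes "finite A" "\<And>i. i \<in> A \<Longrightarrow> f i differentiable_on S"
  shows "(\<lambda>x. \<Sum>i\<in>A. f i x) differentiable_on S"
  using assms by (auto simp: differentiable_on_def intro!: differentiable_sum)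

lemma differentiable_on_powi [derivative_intros]:
  fixes f :: "'a::real_normed_vector \<Rightarrow> 'b::real_normed_field"
  assumes "f differentiable_on S" "\<And>x. x \<in> S \<Longrightarrow> f x \<noteq> 0"
  shows "(\<lambda>x. f x powi n) differentiable_on S"
  using assms by (auto simp: differentiable_on_def intro!: differentiable_power_int)

context tube_domain
begin

lemma e_real: "k \<in> {1..b} \<Longrightarrow> (e k, 0) \<in> K \<times> K"
  and e_imag: "k \<in> {1..b} \<Longrightarrow> (0, e k) \<in> K \<times> K"
  using e_in_K subspace_0[OF subspace_K] by auto

text \<open>\<open>ddir\<close> uses a two-sided derivative in \<open>t\<close>, while
  \<open>F\<close> is controlled only on \<open>U\<close>. The line stays in \<open>U\<close> for
  \<open>t\<close> in an open set \<open>S\<close>, where \<open>at 0 within S\<close> is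
  \<open>at 0\<close>.\<close>

lemma ddir_eq:
  assumes F: "(F has_derivative F') (at Z within U)" and Z: "Z \<in> U" and u: "u \<in> K \<times> K"
  shows "ddir u F Z = F' u"
proof -
  obtain S where S: "open S" "(0::real) \<in> S" "\<And>t. t \<in> S \<Longrightarrow> Z + t *\<^sub>R u \<in> U"
    using eventually_tube[OF Z u] unfolding eventually_nhds by blast
  have "((\<lambda>t::real. Z + t *\<^sub>R u) has_derivative (\<lambda>t. t *\<^sub>R u)) (at 0 within S)"
    by (auto intro!: derivative_eq_intros)
  moreover have "(F has_derivative F') (at (Z + 0 *\<^sub>R u) within (\<lambda>t. Z + t *\<^sub>R u) ` S)"
    using has_derivative_subset[OF F, of "(\<lambda>t. Z + t *\<^sub>R u) ` S"] S by auto
  ultimately have "((\<lambda>t. F (Z + t *\<^sub>R u)) has_derivative (\<lambda>t. F' (t *\<^sub>R u))) (at 0 within S)"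
    by (rule has_derivative_in_compose)
  then have "((\<lambda>t. F (Z + t *\<^sub>R u)) has_vector_derivative F' u) (at 0)"
    using S at_within_open[of 0 S] linear_scale[OF has_derivative_linear[OF F]]
    by (simp add: has_vector_derivative_def)
  then show ?thesis unfolding ddir_def by (rule vector_derivative_at)
qed

lemma ddir_cong:
  assumes "\<And>W. W \<in> U \<Longrightarrow> F W = G W" "Z \<in> U" "u \<in> K \<times> K"
  shows "ddir u F Z = ddir u G Z"
  unfolding ddir_def
proof (rule vector_derivative_cong_eq)
  show "\<forall>\<^sub>F t in nhds 0. t \<in> UNIV \<longrightarrow> F (Z + t *\<^sub>R u) = G (Z + t *\<^sub>R u)"
    using eventually_tube[OF assms(2,3)] by eventually_elim (simp add: assms(1))
qed auto

text \<open>Allows identities that hold only on the tube domain to be differentiated.\<close>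

lemma dz_cong:
  assumes "\<And>W. W \<in> U \<Longrightarrow> F W = G W" "Z \<in> U" "k \<in> {1..b}"
  shows "dz e k F Z = dz e k G Z"
  using ddir_cong[OF assms(1,2)] e_real[OF assms(3)] e_imag[OF assms(3)] by (simp add: dz_def)

lemma dz_eq:
  assumes "(F has_derivative F') (at Z within U)" "Z \<in> U" "k \<in> {1..b}"
  shows "dz e k F Z = (F' (e k, 0) - \<i> * F' (0, e k)) / 2"
  using ddir_eq[OF assms(1,2)] e_real[OF assms(3)] e_imag[OF assms(3)] by (simp add: dz_def)

lemma dzbar_eq:
  assumes "(F has_derivative F') (at Z within U)" "Z \<in> U" "k \<in> {1..b}"
  shows "dzbar e k F Z = (F' (e k, 0) + \<i> * F' (0, e k)) / 2"
  using ddir_eq[OF assms(1,2)] e_real[OF assms(3)] e_imag[OF assms(3)] by (simp add: dzbar_def)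

lemma tube_derivative:
  assumes "F differentiable_on U" "Z \<in> U"
  obtains F' where "(F has_derivative F') (at Z within U)"
  using assms by (auto simp: differentiable_on_def differentiable_def)

lemma dz_mult:
  assumes "F differentiable_on U" "G differentiable_on U" "Z \<in> U" "k \<in> {1..b}"
  shows "dz e k (\<lambda>W. F W * G W) Z = dz e k F Z * G Z + F Z * dz e k G Z"
proof -
  obtain F' G' where F: "(F has_derivative F') (at Z within U)" and G: "(G has_derivative G') (at Z within U)"
    using tube_derivative assms by metis
  show ?thesis
    unfolding dz_eq[OF F assms(3,4)] dz_eq[OF G assms(3,4)]
      dz_eq[OF has_derivative_mult[OF F G] assms(3,4)]
    by (simp add: field_simps)
qed

lemma dz_sum:
  assumes "finite A" "\<And>i. i \<in> A \<Longrightarrow> F i differentiable_on U" "Z \<in> U" "k \<in> {1..b}"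
  shows "dz e k (\<lambda>W. \<Sum>i\<in>A. F i W) Z = (\<Sum>i\<in>A. dz e k (F i) Z)"
proof -
  have "\<exists>D. \<forall>i\<in>A. (F i has_derivative D i) (at Z within U)"
    using assms(2,3) by (intro bchoice) (auto simp: differentiable_on_def differentiable_def)
  then obtain D where D: "\<And>i. i \<in> A \<Longrightarrow> (F i has_derivative D i) (at Z within U)"
    by blast
  have "dz e k (F i) Z = (D i (e k, 0) - \<i> * D i (0, e k)) / 2" if "i \<in> A" for i
    by (rule dz_eq[OF D[OF that] assms(3,4)])
  moreover have "dz e k (\<lambda>W. \<Sum>i\<in>A. F i W) Z =
      ((\<Sum>i\<in>A. D i (e k, 0)) - \<i> * (\<Sum>i\<in>A. D i (0, e k))) / 2"
    by (rule dz_eq[OF has_derivative_sum[OF D] assms(3,4)])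
  ultimately show ?thesis
    by (simp add: sum_divide_distrib sum_subtractf sum_distrib_left diff_divide_distrib)
qed

lemma dz_const: "Z \<in> U \<Longrightarrow> k \<in> {1..b} \<Longrightarrow> dz e k (\<lambda>_. c) Z = 0"
  using dz_eq[OF has_derivative_const] by simp

lemma dz_cmult:
  assumes "F differentiable_on U" "Z \<in> U" "k \<in> {1..b}"
  shows "dz e k (\<lambda>W. c * F W) Z = c * dz e k F Z"
  using dz_mult[OF _ assms, of "\<lambda>_. c"] dz_const assms by simp

lemma dz_cnj:
  assumes "F differentiable_on U" "Z \<in> U" "k \<in> {1..b}"
  shows "dz e k (\<lambda>W. cnj (F W)) Z = cnj (dzbar e k F Z)"
proof -
  obtain F' where F: "(F has_derivative F') (at Z within U)"
    using tube_derivative assms by metis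
  show ?thesis
    unfolding dzbar_eq[OF F assms(2,3)]
      dz_eq[OF bounded_linear.has_derivative[OF bounded_linear_cnj F] assms(2,3)]
    by simp
qed

lemma dz_powi:
  assumes "F differentiable_on U" "F Z \<noteq> 0" "Z \<in> U" "k \<in> {1..b}"
  shows "dz e k (\<lambda>W. F W powi n) Z = of_int n * F Z powi (n - 1) * dz e k F Z"
    and "dzbar e k (\<lambda>W. F W powi n) Z = of_int n * F Z powi (n - 1) * dzbar e k F Z"
proof -
  obtain F' where F: "(F has_derivative F') (at Z within U)"
    using tube_derivative assms by metis
  have "((\<lambda>W. F W powi n) has_derivative (\<lambda>u. F' u * (of_int n * F Z powi (n - 1)))) (at Z within U)"
    by (rule has_derivative_power_int[OF _ F]) (use assms in auto)
  note P = this
  show "dz e k (\<lambda>W. F W powi n) Z = of_int n * F Z powi (n - 1) * dz e k F Z"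
    unfolding dz_eq[OF F assms(3,4)] dz_eq[OF P assms(3,4)] by (simp add: field_simps)
  show "dzbar e k (\<lambda>W. F W powi n) Z = of_int n * F Z powi (n - 1) * dzbar e k F Z"
    unfolding dzbar_eq[OF F assms(3,4)] dzbar_eq[OF P assms(3,4)] by (simp add: field_simps)
qed

text \<open>Real differentiability with the Cauchy-Riemann equations in each coordinate.\<close>

definition holo :: "('v cvec \<Rightarrow> complex) \<Rightarrow> bool" where
  "holo f \<longleftrightarrow> f differentiable_on U \<and> (\<forall>Z\<in>U. \<forall>k\<in>{1..b}. dzbar e k f Z = 0)"

lemma holo_mult:
  assumes "holo F" "holo G"
  shows "holo (\<lambda>W. F W * G W)"
  unfolding holo_def
proof (intro conjI ballI)
  show "(\<lambda>W. F W * G W) differentiable_on U"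
    using assms by (auto simp: holo_def)
  fix Z k assume Z: "Z \<in> U" and k: "k \<in> {1..b}"
  obtain F' G' where F: "(F has_derivative F') (at Z within U)" and G: "(G has_derivative G') (at Z within U)"
    using tube_derivative assms Z unfolding holo_def by metis
  have "dzbar e k F Z = 0" "dzbar e k G Z = 0" using assms Z k by (auto simp: holo_def)
  moreover have "dzbar e k (\<lambda>W. F W * G W) Z = dzbar e k F Z * G Z + F Z * dzbar e k G Z"
    unfolding dzbar_eq[OF F Z k] dzbar_eq[OF G Z k] dzbar_eq[OF has_derivative_mult[OF F G] Z k]
    by (simp add: field_simps)
  ultimately show "dzbar e k (\<lambda>W. F W * G W) Z = 0" by simp
qed

lemma holo_powi:
  assumes "holo F" "\<And>Z. Z \<in> U \<Longrightarrow> F Z \<noteq> 0"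
  shows "holo (\<lambda>W. F W powi n)"
  using assms by (auto simp: holo_def dz_powi intro!: derivative_intros)

lemma holo_const: "holo (\<lambda>_. c)"
  by (auto simp: holo_def dzbar_eq[OF has_derivative_const])

text \<open>The general Wirtinger chain rule also has terms with \<open>dzbar e j F\<close>,
  multiplied by \<open>dz\<close> of the conjugate of \<open>p j\<close>. They vanish for
  holomorphic \<open>p j\<close>, while \<open>F\<close> itself need not be holomorphic.\<close>

lemma holo_compose:
  assumes p: "\<And>j. j \<in> {1..b} \<Longrightarrow> holo (p j)"
    and maps: "\<And>W. W \<in> U \<Longrightarrow> cbasis_sum (\<lambda>j. p j W) \<in> U"
    and F: "F differentiable_on U"
  shows "(\<lambda>W. F (cbasis_sum (\<lambda>j. p j W))) differentiable_on U"
    and "Z \<in> U \<Longrightarrow> k \<in> {1..b} \<Longrightarrow> dz e k (\<lambda>W. F (cbasis_sum (\<lambda>j. p j W))) Z =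
      (\<Sum>j\<in>{1..b}. dz e k (p j) Z * dz e j F (cbasis_sum (\<lambda>j. p j Z)))"
proof -
  let ?phi = "\<lambda>W. cbasis_sum (\<lambda>j. p j W)"
  have ex: "\<exists>p' F'. (\<forall>j\<in>{1..b}. (p j has_derivative p' j) (at Z within U)) \<and>
      (F has_derivative F') (at (?phi Z) within U) \<and>
      ((\<lambda>W. F (?phi W)) has_derivative (\<lambda>u. F' (cbasis_sum (\<lambda>j. p' j u)))) (at Z within U)"
    if Z: "Z \<in> U" for Z
  proof -
    have "\<exists>D. \<forall>j\<in>{1..b}. (p j has_derivative D j) (at Z within U)"
      using p Z by (intro bchoice) (auto simp: holo_def differentiable_on_def differentiable_def)
    then obtain p' where p': "\<And>j. j \<in> {1..b} \<Longrightarrow> (p j has_derivative p' j) (at Z within U)"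
      by blast
    obtain F' where F': "(F has_derivative F') (at (?phi Z) within U)"
      using tube_derivative[OF F maps[OF Z]] by blast
    have "(?phi has_derivative (\<lambda>u. cbasis_sum (\<lambda>j. p' j u))) (at Z within U)"
      unfolding cbasis_sum_def
      by (intro has_derivative_sum bounded_linear.has_derivative[OF bounded_linear_cscale] p')
    moreover have "(F has_derivative F') (at (?phi Z) within ?phi ` U)"
      by (rule has_derivative_subset[OF F']) (use maps in auto)
    ultimately have "((\<lambda>W. F (?phi W)) has_derivative (\<lambda>u. F' (cbasis_sum (\<lambda>j. p' j u)))) (at Z within U)"
      by (rule has_derivative_in_compose)
    then show ?thesis using p' F' by blast
  qed
  show "(\<lambda>W. F (?phi W)) differentiable_on U"
    unfolding differentiable_on_def differentiable_def using ex by blast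
  assume Z: "Z \<in> U" and k: "k \<in> {1..b}"
  obtain p' F' where p': "\<And>j. j \<in> {1..b} \<Longrightarrow> (p j has_derivative p' j) (at Z within U)"
    and F': "(F has_derivative F') (at (?phi Z) within U)"
    and FP: "((\<lambda>W. F (?phi W)) has_derivative (\<lambda>u. F' (cbasis_sum (\<lambda>j. p' j u)))) (at Z within U)"
    using ex[OF Z] by blast
  interpret F': linear F' by (rule has_derivative_linear[OF F'])
  have cs: "cscale c (e j, 0) = Re c *\<^sub>R (e j, 0) + Im c *\<^sub>R (0, e j)" for c j
    by (simp add: cscale_def)
  have expand: "F' (cbasis_sum c) = (\<Sum>j\<in>{1..b}. Re (c j) * F' (e j, 0) + Im (c j) * F' (0, e j))" for c
    unfolding cbasis_sum_def F'.sum cs F'.add F'.scale by (simp add: scaleR_conv_of_real)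
  have dj: "dz e j F (?phi Z) = (F' (e j, 0) - \<i> * F' (0, e j)) / 2" if "j \<in> {1..b}" for j
    by (rule dz_eq[OF F' maps[OF Z] that])
  \<comment> \<open>The Cauchy-Riemann equation read as complex linearity of the derivative of
    \<open>p j\<close>.\<close>
  have hol: "p' j (0, e k) = \<i> * p' j (e k, 0)" if j: "j \<in> {1..b}" for j
  proof -
    have "p' j (e k, 0) + \<i> * p' j (0, e k) = 0"
      using p[OF j] dzbar_eq[OF p'[OF j] Z k] Z k by (auto simp: holo_def)
    then have "\<i> * (p' j (e k, 0) + \<i> * p' j (0, e k)) = 0" by simp
    then show ?thesis by (simp add: algebra_simps)
  qed
  have pj: "dz e k (p j) Z = p' j (e k, 0)" if "j \<in> {1..b}" for j
    using dz_eq[OF p'[OF that] Z k] hol[OF that] by simp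
  have "dz e k (\<lambda>W. F (?phi W)) Z =
    (F' (cbasis_sum (\<lambda>j. p' j (e k, 0))) - \<i> * F' (cbasis_sum (\<lambda>j. p' j (0, e k)))) / 2"
    by (rule dz_eq[OF FP Z k])
  also have "\<dots> = (\<Sum>j\<in>{1..b}. ((Re (p' j (e k, 0)) * F' (e j, 0) + Im (p' j (e k, 0)) * F' (0, e j))
      - \<i> * (Re (p' j (0, e k)) * F' (e j, 0) + Im (p' j (0, e k)) * F' (0, e j))) / 2)"
    unfolding expand sum_distrib_left sum_subtractf[symmetric] sum_divide_distrib by (rule refl)
  also have "\<dots> = (\<Sum>j\<in>{1..b}. dz e k (p j) Z * dz e j F (?phi Z))"
  proof (rule sum.cong)
    fix j assume j: "j \<in> {1..b}"
    define a where "a = p' j (e k, 0)"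
    \<comment> \<open>The real-linear \<open>F'\<close> evaluated at \<open>a\<close> and at
      \<open>\<i> * a\<close> combines to \<open>a\<close> times the Wirtinger derivative.\<close>
    have "(Re a * F' (e j, 0) + Im a * F' (0, e j)) - \<i> * (- Im a * F' (e j, 0) + Re a * F' (0, e j))
      = (Re a + \<i> * Im a) * (F' (e j, 0) - \<i> * F' (0, e j))"
      by (simp add: algebra_simps)
    also have "Re a + \<i> * Im a = a" by (simp add: complex_eq_iff)
    finally have "(Re a * F' (e j, 0) + Im a * F' (0, e j)) - \<i> * (- Im a * F' (e j, 0) + Re a * F' (0, e j))
      = a * (F' (e j, 0) - \<i> * F' (0, e j))" .
    then show "((Re (p' j (e k, 0)) * F' (e j, 0) + Im (p' j (e k, 0)) * F' (0, e j))
      - \<i> * (Re (p' j (0, e k)) * F' (e j, 0) + Im (p' j (0, e k)) * F' (0, e j))) / 2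
      = dz e k (p j) Z * dz e j F (?phi Z)"
      unfolding pj[OF j] dj[OF j] hol[OF j] a_def[symmetric] by simp
  qed simp
  finally show "dz e k (\<lambda>W. F (?phi W)) Z = (\<Sum>j\<in>{1..b}. dz e k (p j) Z * dz e j F (?phi Z))" .
qed

text \<open>Enough regularity to apply the rules for \<open>dz\<close> twice, and stable under
  \<open>Ypow\<close> and under pullback by the action. \<open>Lop\<close> is treated by applying it
  to the conjugate function.\<close>

definition twice_diff :: "('v cvec \<Rightarrow> complex) \<Rightarrow> bool" where
  "twice_diff F \<longleftrightarrow> F differentiable_on U \<and> (\<forall>k\<in>{1..b}. dz e k F differentiable_on U)"

text \<open>Evaluation of the derivative at a fixed direction is bounded linear, so directional
  derivatives inherit differentiability. For the conjugate, \<open>dz_cnj\<close> passes to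
  \<open>dzbar\<close> of \<open>F\<close>.\<close>

lemma C2_on_twice_diff:
  assumes "C2_on U F"
  shows "twice_diff F" and "twice_diff (\<lambda>W. cnj (F W))"
proof -
  obtain F' :: "'v cvec \<Rightarrow> 'v cvec \<Rightarrow>\<^sub>L complex" and F'' :: "'v cvec \<Rightarrow> 'v cvec \<Rightarrow>\<^sub>L 'v cvec \<Rightarrow>\<^sub>L complex"
    where F': "\<And>Z. Z \<in> U \<Longrightarrow> (F has_derivative blinfun_apply (F' Z)) (at Z within U)"
    and F'': "\<And>Z. Z \<in> U \<Longrightarrow> (F' has_derivative blinfun_apply (F'' Z)) (at Z within U)"
    using assms unfolding C2_on_def by blast
  have F: "F differentiable_on U"
    using F' by (auto simp: differentiable_on_def differentiable_def)
  have dir: "(\<lambda>Z. blinfun_apply (F' Z) u) differentiable_on U" for u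
    unfolding differentiable_on_def differentiable_def
    using bounded_linear.has_derivative[OF blinfun.bounded_linear_left F''] by blast
  have D: "dz e k F differentiable_on U" if k: "k \<in> {1..b}" for k
    by (rule differentiable_on_cong[of "\<lambda>Z. (F' Z (e k, 0) - \<i> * F' Z (0, e k)) * (1 / 2)"])
      (intro derivative_intros dir, simp add: dz_eq[OF F' _ k])
  have Dbar: "dzbar e k F differentiable_on U" if k: "k \<in> {1..b}" for k
    by (rule differentiable_on_cong[of "\<lambda>Z. (F' Z (e k, 0) + \<i> * F' Z (0, e k)) * (1 / 2)"])
      (intro derivative_intros dir, simp add: dzbar_eq[OF F' _ k])
  show "twice_diff F" using F D by (simp add: twice_diff_def)
  have "dz e k (\<lambda>W. cnj (F W)) differentiable_on U" if k: "k \<in> {1..b}" for k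
    by (rule differentiable_on_cong[OF differentiable_on_cnj[OF Dbar[OF k]]])
      (use dz_cnj[OF F _ k] in auto)
  then show "twice_diff (\<lambda>W. cnj (F W))"
    using F by (auto simp: twice_diff_def intro: derivative_intros)
qed

end

section \<open>The operators in terms of gradients\<close>

context tube_domain
begin

text \<open>The complex bilinear pairing of gradients, without conjugation.\<close>

definition cip :: "(nat \<Rightarrow> complex) \<Rightarrow> (nat \<Rightarrow> complex) \<Rightarrow> complex" where
  "cip u v = (\<Sum>k\<in>{1..b}. complex_of_real (basis_sign k) * u k * v k)"

lemma cip_commute: "cip u v = cip v u"
  by (simp add: cip_def mult_ac)

lemma cip_lincomb:
  "cip (\<lambda>k. x * u k + y * v k) w = x * cip u w + y * cip v w"
  by (simp add: cip_def sum.distrib sum_distrib_left algebra_simps)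

lemma cip_diff: "cip (\<lambda>k. u k - v k) w = cip u w - cip v w"
  by (simp add: cip_def sum_subtractf algebra_simps)

lemma cip_mult: "cip (\<lambda>k. x * u k) w = x * cip u w"
  by (simp add: cip_def sum_distrib_left algebra_simps)

lemma cip_cong:
  "(\<And>k. k \<in> {1..b} \<Longrightarrow> u k = u' k) \<Longrightarrow> (\<And>k. k \<in> {1..b} \<Longrightarrow> v k = v' k) \<Longrightarrow> cip u v = cip u' v'"
  by (simp add: cip_def)

lemma cip_sum: "cip (\<lambda>k. \<Sum>j\<in>A. u j k) w = (\<Sum>j\<in>A. cip (u j) w)"
  unfolding cip_def sum_distrib_left sum_distrib_right by (rule sum.swap)

text \<open>The trace through which the dimension enters the Laplacians.\<close>

lemma sum_basis_sign: "(\<Sum>k\<in>{1..b}. complex_of_real (basis_sign k) * basis_sign k) = b"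
  by (simp add: of_real_mult[symmetric] del: of_real_mult)

lemma Deltah_eq: "Deltah e b F Z = (\<Sum>k\<in>{1..b}. basis_sign k * dz e k (dz e k F) Z)"
  and Deltahbar_eq: "Deltahbar e b F Z = (\<Sum>k\<in>{1..b}. basis_sign k * dzbar e k (dzbar e k F) Z)"
proof -
  have "{1..b} = insert 1 {2..b}" using b_pos by auto
  then show "Deltah e b F Z = (\<Sum>k\<in>{1..b}. basis_sign k * dz e k (dz e k F) Z)"
    "Deltahbar e b F Z = (\<Sum>k\<in>{1..b}. basis_sign k * dzbar e k (dzbar e k F) Z)"
    by (simp_all add: Deltah_def Deltahbar_def basis_sign_def sum_negf)
qed

text \<open>In these coordinates an isometry acts by quotients of the functions \<open>pairing w\<close>.\<close>

definition pairing :: "'v \<Rightarrow> 'v cvec \<Rightarrow> complex" where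
  "pairing w Z = cform B (ZV B z \<zeta> Z) (w, 0)"

text \<open>The gradient of \<open>pairing w\<close>, as \<open>dz_pairing\<close> shows. It is
  affine in \<open>Z\<close>, so the second derivatives are constants.\<close>

definition grad :: "'v \<Rightarrow> nat \<Rightarrow> 'v cvec \<Rightarrow> complex" where
  "grad w k Z = complex_of_real (B (e k) w) - complex_of_real (B z w) * cform B (e k, 0) Z"

lemma pairing_eq:
  "pairing w Z = cform B Z (w, 0) + B \<zeta> w - (cform B Z Z + B \<zeta> \<zeta>) * (B z w / 2)"
  by (simp add: pairing_def ZV_alt cform_simps cform_cscale_left cform_real)

lemma pairing_has_derivative:
  "(pairing w has_derivative (\<lambda>u. cform B u (w, 0) - B z w * cform B u Z)) (at Z within S)"
proof -
  have 1: "((\<lambda>Z. cform B Z (w, 0)) has_derivative (\<lambda>u. cform B u (w, 0))) (at Z within S)"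
    by (rule bounded_linear_imp_has_derivative
        [OF bounded_bilinear.bounded_linear_left[OF bounded_bilinear_cform]])
  have 2: "((\<lambda>Z. cform B Z Z) has_derivative (\<lambda>u. cform B Z u + cform B u Z)) (at Z within S)"
    by (rule bounded_bilinear.FDERIV[OF bounded_bilinear_cform has_derivative_ident has_derivative_ident])
  have eq: "pairing w = (\<lambda>Z. cform B Z (w, 0) + B \<zeta> w - (cform B Z Z + B \<zeta> \<zeta>) * (B z w / 2))"
    by (rule ext) (rule pairing_eq)
  show ?thesis
    unfolding eq
    by (rule has_derivative_eq_rhs, rule has_derivative_diff[OF has_derivative_add[OF 1 has_derivative_const]
          has_derivative_mult_left[OF has_derivative_add[OF 2 has_derivative_const]]])
      (auto simp: cform_sym[of Z])
qed

text \<open>\<open>(0, x)\<close> is \<open>\<i>\<close> times \<open>(x, 0)\<close>; this turns the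
  real derivatives of \<open>pairing\<close> and \<open>grad\<close> into Wirtinger
  derivatives.\<close>

lemma cform_imag: "cform B (0, x) W = \<i> * cform B (x, 0) W"
  by (simp add: cform_def complex_eq_iff B_simps)

lemma pairing_differentiable: "pairing w differentiable_on U"
  unfolding differentiable_on_def differentiable_def using pairing_has_derivative by blast

lemma dz_pairing:
  assumes "Z \<in> U" "k \<in> {1..b}"
  shows "dz e k (pairing w) Z = grad w k Z"
  by (simp add: dz_eq[OF pairing_has_derivative assms] cform_imag cform_real grad_def field_simps)

lemma holo_pairing: "holo (pairing w)"
  unfolding holo_def
  by (auto simp: dzbar_eq[OF pairing_has_derivative] cform_imag pairing_differentiable field_simps)

lemma grad_has_derivative:
  "(grad w k has_derivative (\<lambda>u. - (B z w * cform B (e k, 0) u))) (at Z within S)"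
proof -
  have 1: "((\<lambda>Z. cform B (e k, 0) Z) has_derivative (\<lambda>u. cform B (e k, 0) u)) (at Z within S)"
    by (rule bounded_linear_imp_has_derivative
        [OF bounded_bilinear.bounded_linear_right[OF bounded_bilinear_cform]])
  have eq: "grad w k = (\<lambda>Z. B (e k) w - B z w * cform B (e k, 0) Z)"
    by (rule ext) (rule grad_def)
  show ?thesis
    unfolding eq
    by (rule has_derivative_eq_rhs,
        rule has_derivative_diff[OF has_derivative_const has_derivative_mult_right[OF 1]]) auto
qed

lemma grad_differentiable: "grad w k differentiable_on U"
  unfolding differentiable_on_def differentiable_def using grad_has_derivative by blast

text \<open>The Hessian of \<open>pairing w\<close> is a multiple of the form; \<open>Deltah\<close>
  sees only its diagonal.\<close>

lemma dz_grad:
  assumes "Z \<in> U" "k \<in> {1..b}"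
  shows "dz e k (grad w k) Z = - (basis_sign k * B z w)"
  using assms
  by (simp add: dz_eq[OF grad_has_derivative assms] cform_sym[of "(e k, 0)"] cform_imag cform_real
      B_e field_simps)

text \<open>Expand the product of two affine functions: the constant part is
  \<open>parseval_V\<close>, the linear and quadratic parts are \<open>cparseval\<close>. The terms
  with \<open>\<zeta>\<close> recombine into the two pairings.\<close>

lemma cip_grad:
  assumes "Z \<in> U"
  shows "cip (\<lambda>k. grad w k Z) (\<lambda>k. grad w' k Z) =
    B w w' - B z w * pairing w' Z - B z w' * pairing w Z"
proof -
  have ZK: "Z \<in> K \<times> K" using assms tube_subset by auto
  have 1: "(\<Sum>k\<in>{1..b}. complex_of_real (basis_sign k) * B (e k) w * B (e k) w') =
      complex_of_real (B w w' - B w z * B w' \<zeta> - B w' z * B w \<zeta> + B w z * B w' z * B \<zeta> \<zeta>)"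
    unfolding parseval_V[symmetric] by (simp add: sym[of "e _" w] sym[of "e _" w'])
  have 2: "(\<Sum>k\<in>{1..b}. basis_sign k * cform B (e k, 0) Z * B (e k) v) = cform B Z (v, 0)" for v
  proof -
    have "(\<Sum>k\<in>{1..b}. basis_sign k * cform B (e k, 0) Z * B (e k) v) =
        (\<Sum>k\<in>{1..b}. basis_sign k * cform B Z (e k, 0) * cform B (v, 0) (e k, 0))"
      by (intro sum.cong refl) (simp add: cform_real cform_sym[of Z "(e _, 0)"] sym[of "e _" v])
    then show ?thesis unfolding cparseval[OF ZK] .
  qed
  have 3: "(\<Sum>k\<in>{1..b}. basis_sign k * cform B (e k, 0) Z * cform B (e k, 0) Z) = cform B Z Z"
    using cparseval[OF ZK, of Z] by (simp add: cform_sym[of "(e _, 0)" Z])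
  have "cip (\<lambda>k. grad w k Z) (\<lambda>k. grad w' k Z) =
      (\<Sum>k\<in>{1..b}. complex_of_real (basis_sign k) * B (e k) w * B (e k) w')
      - B z w * (\<Sum>k\<in>{1..b}. basis_sign k * cform B (e k, 0) Z * B (e k) w')
      - B z w' * (\<Sum>k\<in>{1..b}. basis_sign k * cform B (e k, 0) Z * B (e k) w)
      + B z w * B z w' * (\<Sum>k\<in>{1..b}. basis_sign k * cform B (e k, 0) Z * cform B (e k, 0) Z)"
    unfolding cip_def grad_def sum_distrib_left sum_subtractf[symmetric] sum.distrib[symmetric]
    by (intro sum.cong refl) (simp add: algebra_simps)
  also have "\<dots> = B w w' - B z w * pairing w' Z - B z w' * pairing w Z"
    unfolding 1 2 3 pairing_eq
    by (simp add: sym[of w z] sym[of w' z] sym[of w \<zeta>] sym[of w' \<zeta>] field_simps)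
  finally show ?thesis .
qed

section \<open>Derivatives of functions of \<open>Y^2\<close>\<close>

definition Ysq_grad :: "nat \<Rightarrow> 'v cvec \<Rightarrow> complex" where
  "Ysq_grad k Z = - \<i> * complex_of_real (B (snd Z) (e k))"

lemma Ysq_pos: "Z \<in> U \<Longrightarrow> 0 < Ysq B Z"
  by (simp add: tube_iff)

lemma Ysq_has_derivative:
  "(Ysq B has_derivative (\<lambda>u. 2 * B (snd Z) (snd u))) (at Z within S)"
  unfolding Ysq_def
  by (rule has_derivative_eq_rhs, rule bounded_bilinear.FDERIV[OF bounded_bilinear_B])
    (auto intro!: derivative_intros simp: sym[of "snd Z"])

lemma Ysq_chain:
  assumes "\<And>Z. Z \<in> U \<Longrightarrow> (h has_real_derivative h' (Ysq B Z)) (at (Ysq B Z))"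
  shows "(\<lambda>Z. complex_of_real (h (Ysq B Z))) differentiable_on U"
    and "Z \<in> U \<Longrightarrow> k \<in> {1..b} \<Longrightarrow>
      dz e k (\<lambda>Z. complex_of_real (h (Ysq B Z))) Z = h' (Ysq B Z) * Ysq_grad k Z"
proof -
  have D: "((\<lambda>Z. complex_of_real (h (Ysq B Z))) has_derivative
      (\<lambda>u. complex_of_real (h' (Ysq B W) * (2 * B (snd W) (snd u))))) (at W within U)" if "W \<in> U" for W
    by (intro bounded_linear.has_derivative[OF bounded_linear_of_real]
        has_derivative_compose[OF Ysq_has_derivative]
        assms[OF that, unfolded has_field_derivative_def])
  then show "(\<lambda>Z. complex_of_real (h (Ysq B Z))) differentiable_on U"
    unfolding differentiable_on_def differentiable_def by blast
  show "dz e k (\<lambda>Z. complex_of_real (h (Ysq B Z))) Z = h' (Ysq B Z) * Ysq_grad k Z"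
    if "Z \<in> U" "k \<in> {1..b}"
    by (simp add: dz_eq[OF D[OF that(1)] that] Ysq_grad_def B_simps)
qed

text \<open>The gradient of log \<open>Y^2\<close>, kept as a product so that \<open>dz_mult\<close>
  applies.\<close>

definition log_grad :: "nat \<Rightarrow> 'v cvec \<Rightarrow> complex" where
  "log_grad k Z = Ysq_grad k Z * complex_of_real (inverse (Ysq B Z))"

lemma Ysq_grad_has_derivative:
  "(Ysq_grad k has_derivative (\<lambda>u. - \<i> * B (snd u) (e k))) (at Z within S)"
proof -
  have 1: "((\<lambda>Z. B (snd Z) (e k)) has_derivative (\<lambda>u. B (snd u) (e k))) (at Z within S)"
    by (intro bounded_linear.has_derivative
        [OF bounded_bilinear.bounded_linear_left[OF bounded_bilinear_B]] derivative_intros)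
  have eq: "Ysq_grad k = (\<lambda>Z. - \<i> * complex_of_real (B (snd Z) (e k)))"
    by (rule ext) (simp add: Ysq_grad_def)
  show ?thesis
    unfolding eq
    by (intro has_derivative_mult_right bounded_linear.has_derivative[OF bounded_linear_of_real 1])
qed

lemma dz_Ysq_grad:
  assumes "Z \<in> U" "k \<in> {1..b}"
  shows "dz e k (Ysq_grad k) Z = - (basis_sign k / 2)"
  using assms by (simp add: dz_eq[OF Ysq_grad_has_derivative assms] B_e B_simps)

lemma Ysq_grad_differentiable: "Ysq_grad k differentiable_on U"
  unfolding differentiable_on_def differentiable_def using Ysq_grad_has_derivative by blast

lemma Ysq_inverse:
  shows "(\<lambda>Z. complex_of_real (inverse (Ysq B Z))) differentiable_on U"
    and "Z \<in> U \<Longrightarrow> k \<in> {1..b} \<Longrightarrow> dz e k (\<lambda>Z. complex_of_real (inverse (Ysq B Z))) Z =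
      complex_of_real (- (inverse (Ysq B Z) * inverse (Ysq B Z))) * Ysq_grad k Z"
proof -
  have D: "(inverse has_real_derivative - (inverse (Ysq B Z) * inverse (Ysq B Z))) (at (Ysq B Z))"
    if "Z \<in> U" for Z
    using Ysq_pos[OF that] by (auto intro!: derivative_eq_intros)
  show "(\<lambda>Z. complex_of_real (inverse (Ysq B Z))) differentiable_on U"
    by (rule Ysq_chain(1)[of inverse "\<lambda>y. - (inverse y * inverse y)"]) (rule D)
  show "dz e k (\<lambda>Z. complex_of_real (inverse (Ysq B Z))) Z =
      complex_of_real (- (inverse (Ysq B Z) * inverse (Ysq B Z))) * Ysq_grad k Z"
    if "Z \<in> U" "k \<in> {1..b}"
    by (rule Ysq_chain(2)[of inverse "\<lambda>y. - (inverse y * inverse y)"]) (use D that in auto)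
qed

lemma Ysq_powr:
  shows "(\<lambda>Z. complex_of_real (Ysq B Z powr s)) differentiable_on U"
    and "Z \<in> U \<Longrightarrow> k \<in> {1..b} \<Longrightarrow> dz e k (\<lambda>Z. complex_of_real (Ysq B Z powr s)) Z =
      complex_of_real (s * Ysq B Z powr (s - 1)) * Ysq_grad k Z"
proof -
  have D: "((\<lambda>x. x powr s) has_real_derivative s * Ysq B Z powr (s - 1)) (at (Ysq B Z))"
    if "Z \<in> U" for Z
    using Ysq_pos[OF that] by (auto intro!: derivative_eq_intros simp: powr_diff field_simps)
  show "(\<lambda>Z. complex_of_real (Ysq B Z powr s)) differentiable_on U"
    by (rule Ysq_chain(1)[of "\<lambda>x. x powr s" "\<lambda>x. s * x powr (s - 1)"]) (rule D)
  show "dz e k (\<lambda>Z. complex_of_real (Ysq B Z powr s)) Z =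
      complex_of_real (s * Ysq B Z powr (s - 1)) * Ysq_grad k Z"
    if "Z \<in> U" "k \<in> {1..b}"
    by (rule Ysq_chain(2)[of "\<lambda>x. x powr s" "\<lambda>x. s * x powr (s - 1)"]) (use D that in auto)
qed

lemma log_grad_differentiable: "log_grad k differentiable_on U"
  unfolding log_grad_def[abs_def] by (intro differentiable_on_mult Ysq_grad_differentiable Ysq_inverse)

lemma dz_log_grad:
  assumes Z: "Z \<in> U" and k: "k \<in> {1..b}"
  shows "dz e k (log_grad k) Z = - (basis_sign k / (2 * Ysq B Z)) - (log_grad k Z)\<^sup>2"
proof -
  have "dz e k (log_grad k) Z = - (basis_sign k / 2) * complex_of_real (inverse (Ysq B Z))
      + Ysq_grad k Z * (complex_of_real (- (inverse (Ysq B Z) * inverse (Ysq B Z))) * Ysq_grad k Z)"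
    unfolding log_grad_def[abs_def] dz_mult[OF Ysq_grad_differentiable Ysq_inverse(1) Z k]
      dz_Ysq_grad[OF Z k] Ysq_inverse(2)[OF Z k] by simp
  then show ?thesis by (simp add: log_grad_def power2_eq_square field_simps)
qed

text \<open>Lets the scalar \<open>1 / Ysq\<close> be absorbed into the square of the logarithmic
  gradient, whose behaviour under the action is known.\<close>

lemma cip_log_grad:
  assumes "Z \<in> U"
  shows "cip (\<lambda>k. log_grad k Z) (\<lambda>k. log_grad k Z) = - (1 / Ysq B Z)"
proof -
  have "snd Z \<in> K" using assms tube_subset by auto
  then have P: "(\<Sum>k\<in>{1..b}. basis_sign k * B (snd Z) (e k) * B (snd Z) (e k)) = Ysq B Z"
    unfolding Ysq_def by (rule parseval)
  have "cip (\<lambda>k. log_grad k Z) (\<lambda>k. log_grad k Z) =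
    - complex_of_real ((\<Sum>k\<in>{1..b}. basis_sign k * B (snd Z) (e k) * B (snd Z) (e k)) * (inverse (Ysq B Z))\<^sup>2)"
    unfolding of_real_mult of_real_sum sum_distrib_right sum_negf[symmetric] cip_def
    by (intro sum.cong refl) (simp add: log_grad_def Ysq_grad_def power2_eq_square algebra_simps)
  then show ?thesis
    unfolding P using Ysq_pos[OF assms] by (simp add: power2_eq_square field_simps)
qed

text \<open>Moving \<open>dz e k\<close> past the power of \<open>Y^2\<close> adds the
  multiplication operator \<open>s * log_grad k\<close>.\<close>

lemma dz_Ypow:
  assumes F: "F differentiable_on U"
  shows "Ypow B s F differentiable_on U"
    and "Z \<in> U \<Longrightarrow> k \<in> {1..b} \<Longrightarrow> dz e k (Ypow B s F) Z =
      Ypow B s (\<lambda>W. s * log_grad k W * F W + dz e k F W) Z"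
proof -
  show "Ypow B s F differentiable_on U"
    unfolding Ypow_def[abs_def] using Ysq_powr(1) F by (rule differentiable_on_mult)
  assume Z: "Z \<in> U" and k: "k \<in> {1..b}"
  show "dz e k (Ypow B s F) Z = Ypow B s (\<lambda>W. s * log_grad k W * F W + dz e k F W) Z"
    unfolding Ypow_def[abs_def] dz_mult[OF Ysq_powr(1) F Z k] Ysq_powr(2)[OF Z k]
    using Ysq_pos[OF Z] by (simp add: log_grad_def powr_diff field_simps)
qed

lemma twice_diff_Ypow:
  assumes "twice_diff F"
  shows "twice_diff (Ypow B s F)"
  unfolding twice_diff_def
proof (intro conjI ballI)
  have F: "F differentiable_on U" "\<And>k. k \<in> {1..b} \<Longrightarrow> dz e k F differentiable_on U"
    using assms by (auto simp: twice_diff_def)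
  show "Ypow B s F differentiable_on U" using F(1) by (rule dz_Ypow)
  fix k assume k: "k \<in> {1..b}"
  show "dz e k (Ypow B s F) differentiable_on U"
    by (rule differentiable_on_cong[OF dz_Ypow(1) dz_Ypow(2)[OF F(1) _ k]])
      (intro differentiable_on_add differentiable_on_mult differentiable_on_const F
        log_grad_differentiable k)
qed

text \<open>Apply \<open>dz_Ypow\<close> twice and cancel the outer powers. The zeroth-order
  coefficient becomes s (s - 1 + b/2), and s - 1 + b/2 = m.\<close>

lemma Rop_eq:
  fixes m :: int
  assumes F: "twice_diff F" and Z: "Z \<in> U"
  defines "s \<equiv> complex_of_real (real_of_int m + 1 - real b / 2)"
  shows "Rop B e b m F Z = Deltah e b F Z + 2 * s * cip (\<lambda>k. log_grad k Z) (\<lambda>k. dz e k F Z)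
    + of_int m * s * cip (\<lambda>k. log_grad k Z) (\<lambda>k. log_grad k Z) * F Z"
proof -
  define t where "t = real_of_int m + 1 - real b / 2"
  have st: "s = of_real t" by (simp add: s_def t_def)
  define l where "l = (\<lambda>k. log_grad k Z)"
  have F1: "F differentiable_on U" and F2: "\<And>k. k \<in> {1..b} \<Longrightarrow> dz e k F differentiable_on U"
    using F by (auto simp: twice_diff_def)
  have inner: "dz e k (dz e k (Ypow B t F)) Z =
      complex_of_real (Ysq B Z powr t) * (dz e k (dz e k F) Z + 2 * s * l k * dz e k F Z
        + s * ((s - 1) * (l k)\<^sup>2 - basis_sign k / (2 * Ysq B Z)) * F Z)" if k: "k \<in> {1..b}" for k
  proof -
    have lF: "(\<lambda>W. complex_of_real t * log_grad k W) differentiable_on U"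
      by (intro differentiable_on_mult differentiable_on_const log_grad_differentiable)
    have d: "(\<lambda>W. complex_of_real t * log_grad k W * F W) differentiable_on U"
      using lF F1 by (rule differentiable_on_mult)
    let ?G = "\<lambda>W. complex_of_real t * log_grad k W * F W + dz e k F W"
    have G: "?G differentiable_on U" using d F2[OF k] by (rule differentiable_on_add)
    obtain D1 where D1: "((\<lambda>W. complex_of_real t * log_grad k W * F W) has_derivative D1) (at Z within U)"
      using tube_derivative[OF d Z] .
    obtain D2 where D2: "(dz e k F has_derivative D2) (at Z within U)"
      using tube_derivative[OF F2[OF k] Z] .
    have "dz e k ?G Z = dz e k (\<lambda>W. complex_of_real t * log_grad k W * F W) Z + dz e k (dz e k F) Z"
      unfolding dz_eq[OF D1 Z k] dz_eq[OF D2 Z k] dz_eq[OF has_derivative_add[OF D1 D2] Z k]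
      by (simp add: field_simps)
    then have dG: "dz e k ?G Z = s * (- (basis_sign k / (2 * Ysq B Z)) - (l k)\<^sup>2) * F Z
        + s * l k * dz e k F Z + dz e k (dz e k F) Z"
      unfolding dz_mult[OF lF F1 Z k] dz_cmult[OF log_grad_differentiable Z k] dz_log_grad[OF Z k]
        st l_def by simp
    have "dz e k (dz e k (Ypow B t F)) Z = dz e k (Ypow B t ?G) Z"
      by (rule dz_cong[OF dz_Ypow(2)[OF F1 _ k] Z k])
    also have "\<dots> = complex_of_real (Ysq B Z powr t) * (s * l k * ?G Z + dz e k ?G Z)"
      unfolding dz_Ypow(2)[OF G Z k] by (simp add: Ypow_def st l_def)
    also have "s * l k * ?G Z + dz e k ?G Z = dz e k (dz e k F) Z + 2 * s * l k * dz e k F Z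
        + s * ((s - 1) * (l k)\<^sup>2 - basis_sign k / (2 * Ysq B Z)) * F Z"
      unfolding dG by (simp add: st l_def power2_eq_square algebra_simps)
    finally show ?thesis .
  qed
  have y: "Ysq B Z > 0" using Z by (rule Ysq_pos)
  have "Rop B e b m F Z = Ysq B Z powr (- t) * (\<Sum>k\<in>{1..b}. basis_sign k * dz e k (dz e k (Ypow B t F)) Z)"
  proof -
    have "real b / 2 - real_of_int m - 1 = - t" "real_of_int m + 1 - real b / 2 = t"
      by (simp_all add: t_def)
    note t = this
    show ?thesis unfolding Rop_def t by (simp add: Ypow_def[of B "- t"] Deltah_eq)
  qed
  also have "\<dots> = Ysq B Z powr (- t) * (\<Sum>k\<in>{1..b}. basis_sign k *
      (complex_of_real (Ysq B Z powr t) * (dz e k (dz e k F) Z + 2 * s * l k * dz e k F Z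
        + s * ((s - 1) * (l k)\<^sup>2 - basis_sign k / (2 * Ysq B Z)) * F Z)))"
    using inner by simp
  also have "\<dots> = complex_of_real (Ysq B Z powr (- t) * Ysq B Z powr t) * (Deltah e b F Z
      + 2 * s * cip l (\<lambda>k. dz e k F Z) + s * (s - 1) * cip l l * F Z
      - s * (\<Sum>k\<in>{1..b}. complex_of_real (basis_sign k) * basis_sign k) / (2 * Ysq B Z) * F Z)"
    unfolding Deltah_eq cip_def sum_distrib_left sum_distrib_right sum_divide_distrib
      sum.distrib[symmetric] sum_subtractf[symmetric]
    by (intro sum.cong refl) (simp add: power2_eq_square algebra_simps)
  \<comment> \<open>The trace is \<open>b\<close>, and \<open>cip_log_grad\<close> replaces
    \<open>- 1 / Ysq\<close> by \<open>cip l l\<close>.\<close>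
  also have "\<dots> = Deltah e b F Z + 2 * s * cip l (\<lambda>k. dz e k F Z)
     + s * (s - 1) * cip l l * F Z + s * (b / 2) * cip l l * F Z"
    unfolding sum_basis_sign using y cip_log_grad[OF Z] by (simp add: powr_minus l_def field_simps)
  also have "\<dots> = Deltah e b F Z + 2 * s * cip l (\<lambda>k. dz e k F Z) + of_int m * s * cip l l * F Z"
    by (simp add: s_def field_simps)
  finally show ?thesis by (simp add: l_def)
qed

end

section \<open>The action of an isometry\<close>

locale tube_automorphism = tube_domain +
  fixes M :: "'a \<Rightarrow> 'a"
  assumes M: "M \<in> Oplus B Pp"
begin

definition J :: "'a cvec \<Rightarrow> complex" where
  "J = pairing (inv M z)"

definition N :: "nat \<Rightarrow> 'a cvec \<Rightarrow> complex" where
  "N j = pairing (inv M (e j))"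

text \<open>The \<open>j\<close>-th complex coordinate of the image point; \<open>basis_sign\<close>
  turns the pairing with \<open>e j\<close> into a coordinate.\<close>

definition p :: "nat \<Rightarrow> 'a cvec \<Rightarrow> complex" where
  "p j Z = complex_of_real (basis_sign j) * N j Z * J Z powi (- 1)"

definition img :: "'a cvec \<Rightarrow> 'a cvec" where
  "img Z = cbasis_sum (\<lambda>j. p j Z)"

abbreviation gJ :: "nat \<Rightarrow> 'a cvec \<Rightarrow> complex" where "gJ \<equiv> grad (inv M z)"

abbreviation gN :: "nat \<Rightarrow> nat \<Rightarrow> 'a cvec \<Rightarrow> complex" where "gN j \<equiv> grad (inv M (e j))"

text \<open>\<open>cJ\<close> and \<open>cN\<close> are, up to sign, the constants in the Hessians
  of \<open>J\<close> and \<open>N j\<close>.\<close>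

definition cJ :: complex where "cJ = complex_of_real (B z (inv M z))"

definition cN :: "nat \<Rightarrow> complex" where "cN j = complex_of_real (B z (inv M (e j)))"

text \<open>The gradient of log \<open>J\<close>.\<close>

definition eta :: "nat \<Rightarrow> 'a cvec \<Rightarrow> complex" where
  "eta k Z = gJ k Z * J Z powi (- 1)"

lemma M_inv: "M (inv M x) = x"
  using M by (simp add: Oplus_def bij_is_surj surj_f_inv_f)

lemma M_iso: "B (M x) (M y) = B x y"
  using M by (simp add: Oplus_def)

lemma B_inv: "B (inv M x) (inv M y) = B x y"
  using M_iso[of "inv M x" "inv M y"] by (simp add: M_inv)

lemma cform_M: "cform B (cmap M X) (w, 0) = cform B X (inv M w, 0)"
  using M_iso[of _ "inv M w"] by (simp add: M_inv cform_def B_simps)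

lemma autJ_eq: "Z \<in> U \<Longrightarrow> autJ B z \<zeta> Pp M Z = J Z"
  using act_pair_props(4)[OF M] by (simp add: cform_M J_def pairing_def)

lemma act_eq: "Z \<in> U \<Longrightarrow> act B z \<zeta> Pp M Z = img Z"
  using act_pair_props(5)[OF M]
  by (simp add: cform_M J_def N_def p_def img_def pairing_def power_int_minus field_simps)

lemma J_nonzero: "Z \<in> U \<Longrightarrow> J Z \<noteq> 0"
  using act_pair_props(2)[OF M] autJ_eq by metis

lemma img_in_tube: "Z \<in> U \<Longrightarrow> img Z \<in> U"
  using act_pair_props(1)[OF M] act_eq by metis

lemma Ysq_img: "Z \<in> U \<Longrightarrow> complex_of_real (Ysq B (img Z)) * (J Z * cnj (J Z)) = complex_of_real (Ysq B Z)"
  using Ysq_act[OF M] act_eq autJ_eq by metis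

lemma holo_J: "holo J" and holo_p: "holo (p j)"
proof -
  show J: "holo J" unfolding J_def by (rule holo_pairing)
  show "holo (p j)"
    unfolding p_def[abs_def] N_def
    by (intro holo_mult holo_const holo_pairing holo_powi J J_nonzero)
qed

lemma J_diff: "J differentiable_on U" and p_diff: "p j differentiable_on U"
  and J_powi_diff: "(\<lambda>W. J W powi n) differentiable_on U"
  using holo_J holo_p by (auto simp: holo_def intro!: derivative_intros J_nonzero)

lemma dz_J: "Z \<in> U \<Longrightarrow> k \<in> {1..b} \<Longrightarrow> dz e k J Z = gJ k Z"
  unfolding J_def by (rule dz_pairing)

lemma p_mult_J: "Z \<in> U \<Longrightarrow> p j Z * J Z = basis_sign j * N j Z"
  using J_nonzero by (simp add: p_def power_int_minus field_simps)

text \<open>Differentiating the product \<open>p_mult_J\<close> instead of a quotient avoids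
  denominators; \<open>dz_dz_p_mult_J\<close> differentiates the result once more.\<close>

lemma dz_p_mult_J:
  assumes Z: "Z \<in> U" and k: "k \<in> {1..b}"
  shows "dz e k (p j) Z * J Z = basis_sign j * gN j k Z - p j Z * gJ k Z"
proof -
  have "dz e k (\<lambda>W. p j W * J W) Z = dz e k (\<lambda>W. basis_sign j * N j W) Z"
    by (rule dz_cong[OF p_mult_J Z k])
  then have "dz e k (p j) Z * J Z + p j Z * gJ k Z = basis_sign j * gN j k Z"
    unfolding dz_mult[OF p_diff J_diff Z k] dz_J[OF Z k] N_def
      dz_cmult[OF pairing_differentiable Z k] dz_pairing[OF Z k] .
  then show ?thesis by (simp add: algebra_simps)
qed

lemma dz_p_diff: "k \<in> {1..b} \<Longrightarrow> dz e k (p j) differentiable_on U"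
proof (rule differentiable_on_cong)
  show "(\<lambda>Z. (complex_of_real (basis_sign j) * gN j k Z - p j Z * gJ k Z) * J Z powi (- 1)) differentiable_on U"
    by (intro differentiable_on_mult differentiable_on_diff differentiable_on_const
        grad_differentiable p_diff J_powi_diff)
  show "dz e k (p j) Z = (complex_of_real (basis_sign j) * gN j k Z - p j Z * gJ k Z) * J Z powi (- 1)"
    if "k \<in> {1..b}" "Z \<in> U" for Z
    using dz_p_mult_J[OF that(2,1)] J_nonzero[OF that(2)] by (simp add: power_int_minus field_simps)
qed

lemma dz_dz_p_mult_J:
  assumes Z: "Z \<in> U" and k: "k \<in> {1..b}"
  shows "dz e k (dz e k (p j)) Z * J Z =
    basis_sign k * (p j Z * cJ - basis_sign j * cN j) - 2 * dz e k (p j) Z * gJ k Z"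
proof -
  have eq: "dz e k (p j) W * J W + p j W * gJ k W = basis_sign j * gN j k W" if "W \<in> U" for W
    using dz_p_mult_J[OF that k] by simp
  obtain D1 where D1: "((\<lambda>W. dz e k (p j) W * J W) has_derivative D1) (at Z within U)"
    using tube_derivative[OF differentiable_on_mult[OF dz_p_diff[OF k] J_diff] Z] .
  obtain D2 where D2: "((\<lambda>W. p j W * gJ k W) has_derivative D2) (at Z within U)"
    using tube_derivative[OF differentiable_on_mult[OF p_diff grad_differentiable] Z] .
  have "dz e k (\<lambda>W. dz e k (p j) W * J W + p j W * gJ k W) Z =
      dz e k (\<lambda>W. dz e k (p j) W * J W) Z + dz e k (\<lambda>W. p j W * gJ k W) Z"
    unfolding dz_eq[OF D1 Z k] dz_eq[OF D2 Z k] dz_eq[OF has_derivative_add[OF D1 D2] Z k]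
    by (simp add: field_simps)
  also have "\<dots> = dz e k (dz e k (p j)) Z * J Z + dz e k (p j) Z * gJ k Z
      + (dz e k (p j) Z * gJ k Z + p j Z * (- (basis_sign k * cJ)))"
    unfolding dz_mult[OF dz_p_diff[OF k] J_diff Z k] dz_mult[OF p_diff grad_differentiable Z k]
      dz_J[OF Z k] dz_grad[OF Z k] cJ_def by simp
  finally have "dz e k (\<lambda>W. dz e k (p j) W * J W + p j W * gJ k W) Z = \<dots>" .
  moreover have "dz e k (\<lambda>W. dz e k (p j) W * J W + p j W * gJ k W) Z =
      basis_sign j * (- (basis_sign k * cN j))"
    unfolding cN_def using trans[OF dz_cong[OF eq Z k] dz_cmult[OF grad_differentiable Z k]]
    by (simp add: dz_grad[OF Z k])
  ultimately show ?thesis by (simp add: algebra_simps)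
qed

text \<open>In this and the next two lemmas \<open>B_inv\<close> reduces the constant in
  \<open>cip_grad\<close> to a product among \<open>z\<close> and the \<open>e j\<close>, so it
  vanishes unless two equal basis vectors meet.\<close>

lemma cip_gJ_gJ: "Z \<in> U \<Longrightarrow> cip (\<lambda>k. gJ k Z) (\<lambda>k. gJ k Z) = - 2 * cJ * J Z"
  by (simp add: cip_grad B_inv zz cJ_def J_def)

lemma cip_gN_gJ:
  "Z \<in> U \<Longrightarrow> j \<in> {1..b} \<Longrightarrow> cip (\<lambda>k. gN j k Z) (\<lambda>k. gJ k Z) = - cN j * J Z - cJ * N j Z"
  by (simp add: cip_grad B_inv B_e_z cJ_def cN_def J_def N_def)

lemma cip_gN_gN:
  "Z \<in> U \<Longrightarrow> i \<in> {1..b} \<Longrightarrow> j \<in> {1..b} \<Longrightarrow> cip (\<lambda>k. gN i k Z) (\<lambda>k. gN j k Z) =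
     (if i = j then basis_sign i else 0) - cN i * N j Z - cN j * N i Z"
  by (simp add: cip_grad B_inv B_e cN_def N_def)

lemma cip_dp:
  assumes Z: "Z \<in> U"
  shows "J Z * cip (\<lambda>k. dz e k (p j) Z) v =
    basis_sign j * cip (\<lambda>k. gN j k Z) v - p j Z * cip (\<lambda>k. gJ k Z) v"
proof -
  have "J Z * cip (\<lambda>k. dz e k (p j) Z) v = cip (\<lambda>k. J Z * dz e k (p j) Z) v"
    by (simp add: cip_mult)
  also have "\<dots> = cip (\<lambda>k. basis_sign j * gN j k Z - p j Z * gJ k Z) v"
    by (rule cip_cong) (simp_all add: dz_p_mult_J[OF Z, symmetric] mult.commute)
  finally show ?thesis by (simp add: cip_diff cip_mult)
qed

text \<open>The right-hand side is also the constant-Hessian term in \<open>dz_dz_p_mult_J\<close>.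
  This coincidence makes \<open>Deltah_p\<close> work.\<close>

lemma cip_dp_gJ:
  assumes Z: "Z \<in> U" and j: "j \<in> {1..b}"
  shows "cip (\<lambda>k. dz e k (p j) Z) (\<lambda>k. gJ k Z) = cJ * p j Z - basis_sign j * cN j"
proof -
  have "J Z * cip (\<lambda>k. dz e k (p j) Z) (\<lambda>k. gJ k Z) =
      - basis_sign j * cN j * J Z - cJ * (basis_sign j * N j Z) + 2 * p j Z * cJ * J Z"
    unfolding cip_dp[OF Z] cip_gN_gJ[OF Z j] cip_gJ_gJ[OF Z] by (simp add: algebra_simps)
  also have "\<dots> = J Z * (cJ * p j Z - basis_sign j * cN j)"
    unfolding p_mult_J[OF Z, symmetric] by (simp add: algebra_simps)
  finally show ?thesis using J_nonzero[OF Z] by simp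
qed

text \<open>The map \<open>img\<close> is conformal with factor \<open>J\<^sup>-\<^sup>2\<close>.\<close>

lemma cip_dp_dp:
  assumes Z: "Z \<in> U" and i: "i \<in> {1..b}" and j: "j \<in> {1..b}"
  shows "cip (\<lambda>k. dz e k (p i) Z) (\<lambda>k. dz e k (p j) Z) =
    (if i = j then basis_sign i else 0) * J Z powi (- 2)"
proof -
  let ?c = "cip (\<lambda>k. dz e k (p i) Z) (\<lambda>k. dz e k (p j) Z)"
  have gN: "cip (\<lambda>k. gN i k Z) (\<lambda>k. dz e k (p j) Z) = cip (\<lambda>k. dz e k (p j) Z) (\<lambda>k. gN i k Z)"
    by (rule cip_commute)
  have gJ: "cip (\<lambda>k. gJ k Z) (\<lambda>k. dz e k (p j) Z) = cip (\<lambda>k. dz e k (p j) Z) (\<lambda>k. gJ k Z)"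
    by (rule cip_commute)
  have gN': "cip (\<lambda>k. gJ k Z) (\<lambda>k. gN i k Z) = - cN i * J Z - cJ * N i Z"
    using cip_gN_gJ[OF Z i] by (simp add: cip_commute)
  have d: "complex_of_real (basis_sign i) * complex_of_real (basis_sign i) = 1" for i
    by (simp add: of_real_mult[symmetric] del: of_real_mult)
  have "J Z * ?c = basis_sign i * cip (\<lambda>k. dz e k (p j) Z) (\<lambda>k. gN i k Z)
      - p i Z * (cJ * p j Z - basis_sign j * cN j)"
    unfolding cip_dp[OF Z] gN gJ cip_dp_gJ[OF Z j] ..
  then have "J Z * (J Z * ?c) = J Z * (basis_sign i * cip (\<lambda>k. dz e k (p j) Z) (\<lambda>k. gN i k Z)
      - p i Z * (cJ * p j Z - basis_sign j * cN j))"
    by (rule arg_cong)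
  also have "\<dots> = basis_sign i * (J Z * cip (\<lambda>k. dz e k (p j) Z) (\<lambda>k. gN i k Z))
      - p i Z * J Z * (cJ * p j Z - basis_sign j * cN j)"
    by (simp add: algebra_simps)
  also have "\<dots> = basis_sign i * (basis_sign j * ((if i = j then basis_sign i else 0) - cN j * N i Z - cN i * N j Z)
      - p j Z * (- cN i * J Z - cJ * N i Z)) - p i Z * J Z * (cJ * p j Z - basis_sign j * cN j)"
    unfolding cip_dp[OF Z] gN' cip_gN_gN[OF Z j i] by simp
  \<comment> \<open>Grouped so that each unwanted term contains a difference that vanishes by
    \<open>p_mult_J\<close>.\<close>
  also have "\<dots> = basis_sign i * (basis_sign j * (if i = j then basis_sign i else 0))
      + (cN i * basis_sign i * (p j Z * J Z - basis_sign j * N j Z))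
      + (cJ * p j Z - basis_sign j * cN j) * (basis_sign i * N i Z - p i Z * J Z)"
    by (simp add: algebra_simps)
  also have "\<dots> = (if i = j then basis_sign i else 0)"
    unfolding p_mult_J[OF Z] by (simp add: d mult.assoc[symmetric])
  finally show ?thesis
    using J_nonzero[OF Z] by (simp add: power_int_minus power2_eq_square field_simps)
qed

text \<open>In \<open>dz_dz_p_mult_J\<close> the Hessian term summed over \<open>k\<close> gives b
  times the product in \<open>cip_dp_gJ\<close>, and the first-order term gives -2 times it.\<close>

lemma Deltah_p:
  assumes Z: "Z \<in> U" and j: "j \<in> {1..b}"
  shows "Deltah e b (p j) Z = (of_nat b - 2) * cip (\<lambda>k. dz e k (p j) Z) (\<lambda>k. eta k Z)"
proof -
  let ?c = "cip (\<lambda>k. dz e k (p j) Z) (\<lambda>k. gJ k Z)"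
  have "Deltah e b (p j) Z * J Z =
      (\<Sum>k\<in>{1..b}. basis_sign k * (dz e k (dz e k (p j)) Z * J Z))"
    unfolding Deltah_eq sum_distrib_right by (simp add: mult.assoc)
  also have "\<dots> = (\<Sum>k\<in>{1..b}. basis_sign k *
      (basis_sign k * (p j Z * cJ - basis_sign j * cN j) - 2 * dz e k (p j) Z * gJ k Z))"
    by (intro sum.cong refl) (simp add: dz_dz_p_mult_J[OF Z])
  also have "\<dots> = (\<Sum>k\<in>{1..b}. complex_of_real (basis_sign k) * basis_sign k) * (p j Z * cJ - basis_sign j * cN j) - 2 * ?c"
    unfolding cip_def sum_distrib_left sum_distrib_right sum_subtractf[symmetric]
    by (intro sum.cong refl) (simp add: algebra_simps)
  also have "\<dots> = (of_nat b - 2) * ?c"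
    unfolding sum_basis_sign cip_dp_gJ[OF Z j] by (simp add: algebra_simps)
  finally have 1: "Deltah e b (p j) Z = (of_nat b - 2) * (?c * J Z powi (- 1))"
    using J_nonzero[OF Z] by (simp add: power_int_minus field_simps)
  have "?c * J Z powi (- 1) = cip (\<lambda>k. dz e k (p j) Z) (\<lambda>k. eta k Z)"
    unfolding cip_def eta_def sum_distrib_right by (simp add: mult_ac)
  then show ?thesis using 1 by simp
qed

text \<open>The analogue of \<open>cip_log_grad\<close>: it converts the Hessian constant of
  \<open>J\<close> into a square of \<open>eta\<close>.\<close>

lemma cip_eta: "Z \<in> U \<Longrightarrow> cip (\<lambda>k. eta k Z) (\<lambda>k. eta k Z) = - 2 * cJ * J Z powi (- 1)"
proof -
  assume Z: "Z \<in> U"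
  have "cip (\<lambda>k. eta k Z) (\<lambda>k. eta k Z) =
      J Z powi (- 1) * J Z powi (- 1) * cip (\<lambda>k. gJ k Z) (\<lambda>k. gJ k Z)"
    unfolding cip_def eta_def sum_distrib_left by (simp add: mult_ac)
  then show ?thesis
    using J_nonzero[OF Z] by (simp add: cip_gJ_gJ[OF Z] power_int_minus field_simps)
qed

lemma eta_diff: "eta k differentiable_on U"
  unfolding eta_def[abs_def] by (intro differentiable_on_mult grad_differentiable J_powi_diff)

lemma dz_eta:
  assumes Z: "Z \<in> U" and k: "k \<in> {1..b}"
  shows "dz e k (eta k) Z = - (basis_sign k * cJ * J Z powi (- 1)) - (eta k Z)\<^sup>2"
proof -
  have "dz e k (eta k) Z = - (basis_sign k * cJ) * J Z powi (- 1)
      + gJ k Z * (of_int (- 1) * J Z powi (- 1 - 1) * gJ k Z)"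
    unfolding eta_def[abs_def] dz_mult[OF grad_differentiable J_powi_diff Z k] dz_grad[OF Z k]
      dz_powi(1)[OF J_diff J_nonzero[OF Z] Z k] dz_J[OF Z k] cJ_def by simp
  then show ?thesis
    using J_nonzero[OF Z] by (simp add: eta_def power_int_minus power2_eq_square field_simps)
qed

text \<open>Logarithmic derivative of \<open>Ysq (img Z) * |J Z|\<^sup>2 = Ysq Z\<close>.\<close>

lemma log_grad_img:
  assumes Z: "Z \<in> U" and k: "k \<in> {1..b}"
  shows "(\<Sum>j\<in>{1..b}. dz e k (p j) Z * log_grad j (img Z)) = log_grad k Z - eta k Z"
proof -
  let ?y = "\<lambda>Z. complex_of_real (Ysq B Z)"
  have y: "?y differentiable_on U" "\<And>W k. W \<in> U \<Longrightarrow> k \<in> {1..b} \<Longrightarrow> dz e k ?y W = Ysq_grad k W"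
    using Ysq_chain[of "\<lambda>x. x" "\<lambda>_. 1"] by (auto intro: derivative_eq_intros)
  have yi: "(\<lambda>W. ?y (img W)) differentiable_on U"
    "dz e k (\<lambda>W. ?y (img W)) Z = (\<Sum>j\<in>{1..b}. dz e k (p j) Z * dz e j ?y (img Z))"
    using holo_compose[of p ?y, OF holo_p _ y(1)] img_in_tube Z k unfolding img_def by blast+
  have cnjJ: "(\<lambda>W. cnj (J W)) differentiable_on U" by (rule differentiable_on_cnj[OF J_diff])
  have JJ: "(\<lambda>W. J W * cnj (J W)) differentiable_on U" by (rule differentiable_on_mult[OF J_diff cnjJ])
  \<comment> \<open>The conjugate of a holomorphic function is killed by \<open>dz\<close>, so only
    the factor \<open>J\<close> is differentiated.\<close>
  have "dz e k (\<lambda>W. cnj (J W)) Z = 0"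
    using dz_cnj[OF J_diff Z k] holo_J Z k by (simp add: holo_def)
  then have dJ: "dz e k (\<lambda>W. J W * cnj (J W)) Z = gJ k Z * cnj (J Z)"
    using dz_mult[OF J_diff cnjJ Z k] dz_J[OF Z k] by simp
  have "dz e k (\<lambda>W. ?y (img W) * (J W * cnj (J W))) Z = dz e k ?y Z"
    by (rule dz_cong[OF Ysq_img Z k])
  then have 1: "(\<Sum>j\<in>{1..b}. dz e k (p j) Z * Ysq_grad j (img Z)) * (J Z * cnj (J Z))
      + ?y (img Z) * (gJ k Z * cnj (J Z)) = Ysq_grad k Z"
    unfolding dz_mult[OF yi(1) JJ Z k] dJ yi(2) y(2)[OF Z k] by (simp add: y(2) img_in_tube[OF Z])
  \<comment> \<open>Facts 2 to 5 bring out the common factor \<open>Ysq B Z\<close>, which is then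
    cancelled.\<close>
  have 2: "?y (img Z) * (gJ k Z * cnj (J Z)) = ?y Z * eta k Z"
    using J_nonzero[OF Z] unfolding Ysq_img[OF Z, symmetric]
    by (simp add: eta_def power_int_minus field_simps)
  have 3: "(\<Sum>j\<in>{1..b}. dz e k (p j) Z * Ysq_grad j (img Z)) =
      ?y (img Z) * (\<Sum>j\<in>{1..b}. dz e k (p j) Z * log_grad j (img Z))"
    unfolding sum_distrib_left
    by (intro sum.cong refl) (use Ysq_pos[OF img_in_tube[OF Z]] in \<open>simp add: log_grad_def field_simps\<close>)
  have 4: "Ysq_grad k Z = ?y Z * log_grad k Z"
    using Ysq_pos[OF Z] by (simp add: log_grad_def)
  have 5: "?y (img Z) * (\<Sum>j\<in>{1..b}. dz e k (p j) Z * log_grad j (img Z)) * (J Z * cnj (J Z)) =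
      ?y Z * (\<Sum>j\<in>{1..b}. dz e k (p j) Z * log_grad j (img Z))"
    unfolding Ysq_img[OF Z, symmetric] by (simp add: mult_ac)
  have "?y Z * (\<Sum>j\<in>{1..b}. dz e k (p j) Z * log_grad j (img Z)) + ?y Z * eta k Z
      = ?y Z * log_grad k Z"
    using 1 unfolding 2 3 4 5 .
  then have "?y Z * ((\<Sum>j\<in>{1..b}. dz e k (p j) Z * log_grad j (img Z)) + eta k Z) =
      ?y Z * log_grad k Z"
    by (simp add: distrib_left)
  then have "(\<Sum>j\<in>{1..b}. dz e k (p j) Z * log_grad j (img Z)) + eta k Z = log_grad k Z"
    using Ysq_pos[OF Z] by simp
  then show ?thesis by (simp add: eq_diff_eq)
qed

text \<open>By bilinearity this is \<open>cip_dp_dp\<close>, which leaves only the diagonal of the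
  double sum.\<close>

lemma cip_pullback:
  assumes Z: "Z \<in> U"
  shows "cip (\<lambda>k. \<Sum>j\<in>{1..b}. dz e k (p j) Z * u j) (\<lambda>k. \<Sum>j\<in>{1..b}. dz e k (p j) Z * v j) =
    J Z powi (- 2) * cip u v"
proof -
  let ?d = "\<lambda>j k. dz e k (p j) Z"
  have inner: "cip (?d i) (\<lambda>k. \<Sum>j\<in>{1..b}. v j * ?d j k) = (\<Sum>j\<in>{1..b}. v j * cip (?d j) (?d i))" for i
    by (subst cip_commute) (simp add: cip_sum cip_mult)
  have "cip (\<lambda>k. \<Sum>j\<in>{1..b}. ?d j k * u j) (\<lambda>k. \<Sum>j\<in>{1..b}. ?d j k * v j) =
      (\<Sum>i\<in>{1..b}. cip (\<lambda>k. u i * ?d i k) (\<lambda>k. \<Sum>j\<in>{1..b}. v j * ?d j k))"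
    by (simp add: cip_sum mult.commute)
  also have "\<dots> = (\<Sum>i\<in>{1..b}. \<Sum>j\<in>{1..b}. u i * (v j * cip (?d j) (?d i)))"
    by (simp add: cip_mult inner sum_distrib_left)
  also have "\<dots> = (\<Sum>i\<in>{1..b}. \<Sum>j\<in>{1..b}. if i = j then J Z powi (- 2) * (basis_sign i * u i * v i) else 0)"
    by (intro sum.cong refl) (auto simp: cip_dp_dp[OF Z])
  also have "\<dots> = J Z powi (- 2) * cip u v"
    by (simp add: cip_def sum_distrib_left)
  finally show ?thesis .
qed

lemma dz_pullback:
  assumes F: "F differentiable_on U"
  shows "(\<lambda>W. F (img W)) differentiable_on U"
    and "Z \<in> U \<Longrightarrow> k \<in> {1..b} \<Longrightarrow>
      dz e k (\<lambda>W. F (img W)) Z = (\<Sum>j\<in>{1..b}. dz e k (p j) Z * dz e j F (img Z))"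
  using holo_compose[of p F, OF holo_p _ F] img_in_tube unfolding img_def by blast+

lemma twice_diff_pullback:
  assumes F: "twice_diff F"
  shows "twice_diff (\<lambda>W. F (img W))"
  unfolding twice_diff_def
proof (intro conjI ballI)
  have F1: "F differentiable_on U" and F2: "\<And>j. j \<in> {1..b} \<Longrightarrow> dz e j F differentiable_on U"
    using F by (auto simp: twice_diff_def)
  show "(\<lambda>W. F (img W)) differentiable_on U" by (rule dz_pullback(1)[OF F1])
  fix k assume k: "k \<in> {1..b}"
  show "dz e k (\<lambda>W. F (img W)) differentiable_on U"
    by (rule differentiable_on_cong[OF _ dz_pullback(2)[OF F1 _ k]])
      (intro differentiable_on_finite_sum differentiable_on_mult dz_p_diff k dz_pullback(1) F2, auto)
qed

text \<open>In the chain rule of second order, the second derivatives of the action give the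
  \<open>eta\<close> term by \<open>Deltah_p\<close>, and the products of first derivatives reduce
  to the diagonal by \<open>cip_dp_dp\<close>.\<close>

lemma Deltah_pullback:
  assumes F: "twice_diff F" and Z: "Z \<in> U"
  shows "Deltah e b (\<lambda>W. F (img W)) Z =
    (of_nat b - 2) * cip (\<lambda>k. eta k Z) (\<lambda>k. dz e k (\<lambda>W. F (img W)) Z)
    + J Z powi (- 2) * Deltah e b F (img Z)"
proof -
  let ?d = "\<lambda>j k. dz e k (p j) Z"
  let ?f = "\<lambda>j. dz e j F (img Z)"
  let ?ff = "\<lambda>i j. dz e i (dz e j F) (img Z)"
  have F1: "F differentiable_on U" and F2: "\<And>j. j \<in> {1..b} \<Longrightarrow> dz e j F differentiable_on U"
    using F by (auto simp: twice_diff_def)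
  have second: "dz e k (dz e k (\<lambda>W. F (img W))) Z =
      (\<Sum>j\<in>{1..b}. dz e k (dz e k (p j)) Z * ?f j + ?d j k * (\<Sum>i\<in>{1..b}. ?d i k * ?ff i j))"
    if k: "k \<in> {1..b}" for k
  proof -
    have "dz e k (dz e k (\<lambda>W. F (img W))) Z = dz e k (\<lambda>W. \<Sum>j\<in>{1..b}. dz e k (p j) W * dz e j F (img W)) Z"
      by (rule dz_cong[OF dz_pullback(2)[OF F1 _ k] Z k])
    also have "\<dots> = (\<Sum>j\<in>{1..b}. dz e k (\<lambda>W. dz e k (p j) W * dz e j F (img W)) Z)"
      by (rule dz_sum[OF _ _ Z k]) (intro finite_atLeastAtMost differentiable_on_mult dz_p_diff k dz_pullback(1) F2, simp?)+
    also have "\<dots> = (\<Sum>j\<in>{1..b}. dz e k (dz e k (p j)) Z * ?f j + ?d j k * (\<Sum>i\<in>{1..b}. ?d i k * ?ff i j))"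
      by (intro sum.cong refl)
        (simp only: dz_mult[OF dz_p_diff[OF k] dz_pullback(1)[OF F2] Z k] dz_pullback(2)[OF F2 Z k])
    finally show ?thesis .
  qed
  have "Deltah e b (\<lambda>W. F (img W)) Z = (\<Sum>k\<in>{1..b}. basis_sign k *
      (\<Sum>j\<in>{1..b}. dz e k (dz e k (p j)) Z * ?f j + ?d j k * (\<Sum>i\<in>{1..b}. ?d i k * ?ff i j)))"
    unfolding Deltah_eq by (intro sum.cong refl) (simp only: second)
  also have "\<dots> = (\<Sum>k\<in>{1..b}. \<Sum>j\<in>{1..b}. basis_sign k * dz e k (dz e k (p j)) Z * ?f j
      + (\<Sum>i\<in>{1..b}. basis_sign k * ?d i k * ?d j k * ?ff i j))"
    by (simp add: sum_distrib_left sum.distrib algebra_simps)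
  \<comment> \<open>With the sum over \<open>k\<close> innermost it can be recognised as
    \<open>Deltah\<close> and \<open>cip\<close>.\<close>
  also have "\<dots> = (\<Sum>j\<in>{1..b}. \<Sum>k\<in>{1..b}. basis_sign k * dz e k (dz e k (p j)) Z * ?f j
      + (\<Sum>i\<in>{1..b}. basis_sign k * ?d i k * ?d j k * ?ff i j))"
    by (rule sum.swap)
  also have "\<dots> = (\<Sum>j\<in>{1..b}. Deltah e b (p j) Z * ?f j + (\<Sum>i\<in>{1..b}. cip (?d i) (?d j) * ?ff i j))"
  proof (intro sum.cong refl)
    fix j assume "j \<in> {1..b}"
    have "(\<Sum>k\<in>{1..b}. \<Sum>i\<in>{1..b}. basis_sign k * ?d i k * ?d j k * ?ff i j) =
        (\<Sum>i\<in>{1..b}. \<Sum>k\<in>{1..b}. basis_sign k * ?d i k * ?d j k * ?ff i j)"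
      by (rule sum.swap)
    then show "(\<Sum>k\<in>{1..b}. basis_sign k * dz e k (dz e k (p j)) Z * ?f j
        + (\<Sum>i\<in>{1..b}. basis_sign k * ?d i k * ?d j k * ?ff i j)) =
        Deltah e b (p j) Z * ?f j + (\<Sum>i\<in>{1..b}. cip (?d i) (?d j) * ?ff i j)"
      by (simp add: sum.distrib Deltah_eq cip_def sum_distrib_right)
  qed
  also have "\<dots> = (\<Sum>j\<in>{1..b}. (of_nat b - 2) * cip (?d j) (\<lambda>k. eta k Z) * ?f j)
      + (\<Sum>j\<in>{1..b}. J Z powi (- 2) * (basis_sign j * ?ff j j))"
    unfolding sum.distrib[symmetric]
  proof (intro sum.cong refl)
    fix j assume j: "j \<in> {1..b}"
    have "(\<Sum>i\<in>{1..b}. cip (?d i) (?d j) * ?ff i j) =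
        (\<Sum>i\<in>{1..b}. if i = j then J Z powi (- 2) * (basis_sign j * ?ff j j) else 0)"
      by (intro sum.cong refl) (use j in \<open>auto simp: cip_dp_dp[OF Z]\<close>)
    then show "Deltah e b (p j) Z * ?f j + (\<Sum>i\<in>{1..b}. cip (?d i) (?d j) * ?ff i j) =
        (of_nat b - 2) * cip (?d j) (\<lambda>k. eta k Z) * ?f j + J Z powi (- 2) * (basis_sign j * ?ff j j)"
      using j by (simp add: Deltah_p[OF Z j])
  qed
  also have "(\<Sum>j\<in>{1..b}. (of_nat b - 2) * cip (?d j) (\<lambda>k. eta k Z) * ?f j) =
      (of_nat b - 2) * cip (\<lambda>k. \<Sum>j\<in>{1..b}. ?f j * ?d j k) (\<lambda>k. eta k Z)"
    unfolding cip_sum cip_mult sum_distrib_left by (simp add: mult_ac)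
  also have "cip (\<lambda>k. \<Sum>j\<in>{1..b}. ?f j * ?d j k) (\<lambda>k. eta k Z) =
      cip (\<lambda>k. eta k Z) (\<lambda>k. dz e k (\<lambda>W. F (img W)) Z)"
    by (subst cip_commute, rule cip_cong) (simp_all add: dz_pullback(2)[OF F1 Z] mult.commute)
  finally show ?thesis by (simp add: Deltah_eq sum_distrib_left)
qed

text \<open>The factor \<open>cnj (J W) powi r\<close> is antiholomorphic, hence invisible to \<open>dz\<close>; it is carried along
  because \<open>Lop\<close> is treated by conjugating the case \<open>m = 0\<close>.\<close>

lemma Rop_pullback:
  fixes m r :: int
  assumes F: "twice_diff F" and Z: "Z \<in> U"
  shows "Rop B e b m (\<lambda>W. cnj (J W) powi r * J W powi (- m) * F (img W)) Z =
    cnj (J Z) powi r * J Z powi (- m - 2) * Rop B e b m F (img Z)"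
proof -
  define A where "A W = cnj (J W) powi r * J W powi (- m)" for W
  define f where "f W = F (img W)" for W
  define H where "H W = A W * f W" for W
  have cnjJ: "(\<lambda>W. cnj (J W) powi r) differentiable_on U"
    by (intro differentiable_on_powi differentiable_on_cnj J_diff) (simp add: J_nonzero)
  have A: "A differentiable_on U"
    unfolding A_def[abs_def] by (intro differentiable_on_mult cnjJ J_powi_diff)
  \<comment> \<open>The logarithmic gradient of the automorphy factor is
    \<open>- m * eta\<close>.\<close>
  have dA: "dz e k A W = - (of_int m * eta k W * A W)" if W: "W \<in> U" and k: "k \<in> {1..b}" for W k
  proof -
    have "dz e k (\<lambda>W. cnj (J W) powi r) W = 0"
      using dz_powi(1)[OF differentiable_on_cnj[OF J_diff] _ W k, of r] dz_cnj[OF J_diff W k] holo_J W k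
        J_nonzero[OF W] by (simp add: holo_def)
    then have "dz e k A W = cnj (J W) powi r * (of_int (- m) * J W powi (- m - 1) * gJ k W)"
      unfolding A_def[abs_def] dz_mult[OF cnjJ J_powi_diff W k]
        dz_powi(1)[OF J_diff J_nonzero[OF W] W k] dz_J[OF W k] by simp
    then show ?thesis
      using J_nonzero[OF W] by (simp add: A_def eta_def power_int_diff power_int_minus field_simps)
  qed
  have f2: "twice_diff f" unfolding f_def[abs_def] by (rule twice_diff_pullback[OF F])
  then have f: "f differentiable_on U" and df: "\<And>k. k \<in> {1..b} \<Longrightarrow> dz e k f differentiable_on U"
    by (auto simp: twice_diff_def)
  have Hd: "H differentiable_on U" unfolding H_def[abs_def] by (rule differentiable_on_mult[OF A f])
  have dH: "dz e k H W = (- of_int m) * (eta k W * H W) + A W * dz e k f W"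
    if W: "W \<in> U" and k: "k \<in> {1..b}" for W k
    unfolding H_def[abs_def] dz_mult[OF A f W k] dA[OF W k] by (simp add: algebra_simps)
  have eH: "(\<lambda>W. eta k W * H W) differentiable_on U" for k
    by (rule differentiable_on_mult[OF eta_diff Hd])
  have meH: "(\<lambda>W. (- of_int m) * (eta k W * H W)) differentiable_on U" for k
    by (rule differentiable_on_mult[OF differentiable_on_const eH])
  have Adf: "(\<lambda>W. A W * dz e k f W) differentiable_on U" if "k \<in> {1..b}" for k
    by (rule differentiable_on_mult[OF A df[OF that]])
  have "dz e k H differentiable_on U" if "k \<in> {1..b}" for k
    by (rule differentiable_on_cong[OF differentiable_on_add[OF meH Adf[OF that]] dH[OF _ that]])
  then have H2: "twice_diff H" using Hd by (simp add: twice_diff_def)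
  have ddH: "dz e k (dz e k H) Z =
      of_int m * (of_int m + 1) * (eta k Z * eta k Z) * H Z + of_int m * basis_sign k * cJ * J Z powi (- 1) * H Z
      - 2 * of_int m * A Z * (eta k Z * dz e k f Z) + A Z * dz e k (dz e k f) Z"
    if k: "k \<in> {1..b}" for k
  proof -
    obtain D1 where D1: "((\<lambda>W. (- of_int m) * (eta k W * H W)) has_derivative D1) (at Z within U)"
      using tube_derivative[OF meH Z] .
    obtain D2 where D2: "((\<lambda>W. A W * dz e k f W) has_derivative D2) (at Z within U)"
      using tube_derivative[OF Adf[OF k] Z] .
    have "dz e k (dz e k H) Z = dz e k (\<lambda>W. (- of_int m) * (eta k W * H W) + A W * dz e k f W) Z"
      by (rule dz_cong[OF dH[OF _ k] Z k])
    also have "\<dots> = dz e k (\<lambda>W. (- of_int m) * (eta k W * H W)) Z + dz e k (\<lambda>W. A W * dz e k f W) Z"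
      unfolding dz_eq[OF D1 Z k] dz_eq[OF D2 Z k] dz_eq[OF has_derivative_add[OF D1 D2] Z k]
      by (simp add: field_simps)
    also have "\<dots> = (- of_int m) * ((- (basis_sign k * cJ * J Z powi (- 1)) - (eta k Z)\<^sup>2) * H Z
          + eta k Z * ((- of_int m) * (eta k Z * H Z) + A Z * dz e k f Z))
        + (- (of_int m * eta k Z * A Z) * dz e k f Z + A Z * dz e k (dz e k f) Z)"
      unfolding dz_cmult[OF eH Z k] dz_mult[OF eta_diff Hd Z k] dz_mult[OF A df[OF k] Z k]
        dA[OF Z k] dH[OF Z k] dz_eta[OF Z k] by (rule refl)
    finally show ?thesis by (simp add: power2_eq_square algebra_simps)
  qed
  define et where "et = (\<lambda>k. eta k Z)"
  define lg where "lg = (\<lambda>k. log_grad k Z)"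
  define fg where "fg = (\<lambda>k. dz e k f Z)"
  define s where "s = complex_of_real (real_of_int m + 1 - real b / 2)"
  have "Deltah e b H Z = of_int m * (of_int m + 1) * cip et et * H Z
      + of_int m * (\<Sum>k\<in>{1..b}. complex_of_real (basis_sign k) * basis_sign k) * cJ * J Z powi (- 1) * H Z
      - 2 * of_int m * A Z * cip et fg + A Z * Deltah e b f Z"
    unfolding Deltah_eq cip_def sum_distrib_left sum_distrib_right
      sum.distrib[symmetric] sum_subtractf[symmetric]
    by (intro sum.cong refl) (simp add: ddH et_def fg_def algebra_simps)
  \<comment> \<open>The trace term is rewritten for \<open>cip_eta\<close>; then m (m + 1) - m b/2 =
    m s.\<close>
  also have "\<dots> = of_int m * (of_int m + 1) * cip et et * H Z
      - of_int m * (of_nat b / 2) * (- 2 * cJ * J Z powi (- 1)) * H Z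
      - 2 * of_int m * A Z * cip et fg + A Z * Deltah e b f Z"
    unfolding sum_basis_sign by simp
  also have "\<dots> = of_int m * s * cip et et * H Z - 2 * of_int m * A Z * cip et fg + A Z * Deltah e b f Z"
    unfolding cip_eta[OF Z, symmetric] by (simp add: et_def s_def algebra_simps)
  also have "Deltah e b f Z = (of_nat b - 2) * cip et fg + J Z powi (- 2) * Deltah e b F (img Z)"
    using Deltah_pullback[OF F Z] by (simp add: f_def[abs_def] et_def fg_def)
  \<comment> \<open>The coefficients of \<open>cip et fg\<close> add up to -2m + b - 2 =
    -2s.\<close>
  finally have DH: "Deltah e b H Z = of_int m * s * cip et et * H Z - 2 * s * A Z * cip et fg
      + A Z * J Z powi (- 2) * Deltah e b F (img Z)"
    by (simp add: s_def algebra_simps)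
  have "cip lg (\<lambda>k. dz e k H Z) = cip (\<lambda>k. (- of_int m * H Z) * et k + A Z * fg k) lg"
    by (subst cip_commute, rule cip_cong) (simp_all add: dH[OF Z] et_def fg_def mult_ac)
  then have lH: "cip lg (\<lambda>k. dz e k H Z) = - of_int m * H Z * cip et lg + A Z * cip lg fg"
    unfolding cip_lincomb cip_commute[of fg lg] .
  \<comment> \<open>The \<open>eta\<close> terms of the Laplacian are exactly those that replace the
    logarithmic gradient by its difference with \<open>eta\<close> in both products. This difference
    is the pullback in \<open>log_grad_img\<close>, so \<open>cip_pullback\<close> applies.\<close>
  have "Rop B e b m H Z = of_int m * s * (cip et et - 2 * cip et lg + cip lg lg) * H Z
      + 2 * s * A Z * (cip lg fg - cip et fg) + A Z * J Z powi (- 2) * Deltah e b F (img Z)"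
    using Rop_eq[OF H2 Z, of m] DH lH
    unfolding lg_def[symmetric] s_def[symmetric] by (simp add: algebra_simps)
  also have "cip et et - 2 * cip et lg + cip lg lg = cip (\<lambda>k. lg k - et k) (\<lambda>k. lg k - et k)"
    by (simp add: cip_diff cip_commute[of lg "\<lambda>k. lg k - et k"]
        cip_commute[of et "\<lambda>k. lg k - et k"] cip_commute[of lg et])
  also have "\<dots> = J Z powi (- 2) * cip (\<lambda>j. log_grad j (img Z)) (\<lambda>j. log_grad j (img Z))"
    unfolding cip_pullback[OF Z, symmetric]
    by (rule cip_cong) (simp_all add: log_grad_img[OF Z] lg_def et_def)
  also have "cip lg fg - cip et fg = cip (\<lambda>k. lg k - et k) fg"
    by (simp add: cip_diff)
  also have "\<dots> = J Z powi (- 2) * cip (\<lambda>j. log_grad j (img Z)) (\<lambda>j. dz e j F (img Z))"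
    unfolding cip_pullback[OF Z, symmetric]
    by (rule cip_cong) (use F in \<open>simp_all add: log_grad_img[OF Z] lg_def et_def fg_def f_def[abs_def]
        dz_pullback(2) Z twice_diff_def\<close>)
  finally have "Rop B e b m H Z = A Z * J Z powi (- 2) * Rop B e b m F (img Z)"
    unfolding Rop_eq[OF F img_in_tube[OF Z], of m] s_def[symmetric]
    by (simp add: H_def[of Z] f_def[of Z] algebra_simps)
  then show ?thesis
    using J_nonzero[OF Z]
    by (simp add: H_def[abs_def] A_def f_def power_int_diff power_int_minus field_simps)
qed

end

section \<open>Conjugation and the explicit forms of the operators\<close>

context tube_domain
begin

text \<open>\<open>slash\<close> agrees with its coordinate formula only on the tube domain; this
  lets \<open>Rop\<close> be applied to either.\<close>

lemma Rop_cong: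
  assumes "\<And>W. W \<in> U \<Longrightarrow> F W = G W" "Z \<in> U"
  shows "Rop B e b m F Z = Rop B e b m G Z"
proof -
  have "dz e k (dz e k (Ypow B s F)) Z = dz e k (dz e k (Ypow B s G)) Z" if k: "k \<in> {1..b}" for k s
    by (intro dz_cong k assms(2)) (simp add: Ypow_def assms(1))
  then have "Deltah e b (Ypow B s F) Z = Deltah e b (Ypow B s G) Z" for s
    unfolding Deltah_eq by (intro sum.cong refl) simp
  then show ?thesis by (simp add: Rop_def Ypow_def[of B "real b / 2 - real_of_int m - 1"])
qed

lemma dz_dz_cnj:
  assumes F: "F differentiable_on U" "dzbar e k F differentiable_on U"
    and Z: "Z \<in> U" and k: "k \<in> {1..b}"
  shows "dz e k (dz e k (\<lambda>W. cnj (F W))) Z = cnj (dzbar e k (dzbar e k F) Z)"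
  using dz_cong[OF dz_cnj[OF F(1) _ k] Z k] dz_cnj[OF F(2) Z k] by simp

lemma Deltah_cnj:
  assumes "F differentiable_on U" "\<And>k. k \<in> {1..b} \<Longrightarrow> dzbar e k F differentiable_on U" "Z \<in> U"
  shows "Deltah e b (\<lambda>W. cnj (F W)) Z = cnj (Deltahbar e b F Z)"
  unfolding Deltah_eq Deltahbar_eq using assms by (simp add: dz_dz_cnj)

text \<open>Recovers the regularity of \<open>dzbar e k F\<close> that \<open>Deltah_cnj\<close>
  needs.\<close>

lemma twice_diff_cnj:
  assumes "F differentiable_on U" "twice_diff (\<lambda>W. cnj (F W))" "k \<in> {1..b}"
  shows "dzbar e k F differentiable_on U"
proof (rule differentiable_on_cong)
  show "(\<lambda>W. cnj (dz e k (\<lambda>W. cnj (F W)) W)) differentiable_on U"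
    using assms by (intro differentiable_on_cnj) (auto simp: twice_diff_def)
  show "dzbar e k F W = cnj (dz e k (\<lambda>W. cnj (F W)) W)" if "W \<in> U" for W
    using dz_cnj[OF assms(1) that assms(3)] by simp
qed

text \<open>In \<open>Rop_eq\<close> the signs in \<open>cip\<close> are those of
  \<open>ycoord_eq\<close>, so the first-order term is a multiple of \<open>Dstar\<close>; the last
  term is \<open>cip_log_grad\<close>.\<close>

lemma Rop_expansion:
  fixes m :: int
  assumes F: "twice_diff F" and Z: "Z \<in> U"
  shows "Rop B e b m F Z = Deltah e b F Z
    - \<i> * of_real (2 * of_int m + 2 - real b) / of_real (Ysq B Z) * Dstar e b F Z
    - of_real (of_int m * (2 * of_int m + 2 - real b) / (2 * Ysq B Z)) * F Z"
proof -
  have y: "Ysq B Z \<noteq> 0" using Ysq_pos[OF Z] by simp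
  have "snd Z \<in> K" using Z tube_subset by auto
  then have "cip (\<lambda>k. log_grad k Z) (\<lambda>k. dz e k F Z) = - \<i> / of_real (Ysq B Z) * Dstar e b F Z"
    unfolding cip_def Dstar_def sum_distrib_left
    by (intro sum.cong refl) (simp add: ycoord_eq log_grad_def Ysq_grad_def field_simps)
  then show ?thesis
    unfolding Rop_eq[OF F Z] cip_log_grad[OF Z] using y by (simp add: field_simps)
qed

lemma Lop_eq: "Lop B e b F Z = Ypow B 2 (\<lambda>Z. cnj (Rop B e b 0 (\<lambda>W. cnj (F W)) Z)) Z"
  by (simp add: Lop_def conj_op_def Ypow_def)

text \<open>Real powers of \<open>Y^2\<close> commute with conjugation, and 2 + (b/2 - 1) = b/2 + 1.
  The second form is \<open>Rop_expansion\<close> at m = 0, where the zeroth-order term disappears,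
  and conjugation reverses the sign of \<open>\<i>\<close>.\<close>

lemma Lop_expansions:
  assumes F: "C2_on U F" and Z: "Z \<in> U"
  shows "Lop B e b F Z = Ypow B (real b / 2 + 1) (Deltahbar e b (Ypow B (1 - real b / 2) F)) Z"
    and "Lop B e b F Z = of_real ((Ysq B Z)\<^sup>2) * Deltahbar e b F Z
      + \<i> * of_real (Ysq B Z * (2 - real b)) * Dstarbar e b F Z"
proof -
  have y: "0 < Ysq B Z" by (rule Ysq_pos[OF Z])
  have y2: "Ysq B Z powr 2 = (Ysq B Z)\<^sup>2" using y by (simp add: powr_numeral)
  have F1: "F differentiable_on U" using C2_on_twice_diff(1)[OF F] by (simp add: twice_diff_def)
  note F2 = C2_on_twice_diff(2)[OF F]
  let ?G = "Ypow B (1 - real b / 2) F"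
  have G: "?G differentiable_on U" by (rule dz_Ypow(1)[OF F1])
  have cnjG: "Ypow B (1 - real b / 2) (\<lambda>W. cnj (F W)) = (\<lambda>W. cnj (?G W))"
    by (simp add: Ypow_def[abs_def])
  have "twice_diff (\<lambda>W. cnj (?G W))" unfolding cnjG[symmetric] by (rule twice_diff_Ypow[OF F2])
  then have "Deltah e b (\<lambda>W. cnj (?G W)) Z = cnj (Deltahbar e b ?G Z)"
    by (intro Deltah_cnj G twice_diff_cnj Z)
  then have "Rop B e b 0 (\<lambda>W. cnj (F W)) Z = Ysq B Z powr (real b / 2 - 1) * cnj (Deltahbar e b ?G Z)"
    unfolding Rop_def by (simp add: cnjG Ypow_def[of B "real b / 2 - 1"])
  then have "Lop B e b F Z = complex_of_real (Ysq B Z powr 2 * Ysq B Z powr (real b / 2 - 1)) * Deltahbar e b ?G Z"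
    by (simp add: Lop_eq Ypow_def[of B 2])
  then show "Lop B e b F Z = Ypow B (real b / 2 + 1) (Deltahbar e b ?G) Z"
    unfolding Ypow_def[of B "real b / 2 + 1"] powr_add[symmetric] by (simp add: add.commute)
  have D: "Deltah e b (\<lambda>W. cnj (F W)) Z = cnj (Deltahbar e b F Z)"
    by (intro Deltah_cnj F1 twice_diff_cnj F2 Z)
  have E: "Dstar e b (\<lambda>W. cnj (F W)) Z = cnj (Dstarbar e b F Z)"
    by (simp add: Dstar_def Dstarbar_def dz_cnj[OF F1 Z])
  show "Lop B e b F Z = of_real ((Ysq B Z)\<^sup>2) * Deltahbar e b F Z
      + \<i> * of_real (Ysq B Z * (2 - real b)) * Dstarbar e b F Z"
    unfolding Lop_eq Ypow_def y2 Rop_expansion[OF F2 Z] D E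
    using y by (simp add: field_simps power2_eq_square)
qed

end

section \<open>Equivariance for the slash operators\<close>

context tube_automorphism
begin

lemma slash_eq: "Z \<in> U \<Longrightarrow> slash B z \<zeta> Pp m M F Z = J Z powi (- m) * F (img Z)"
  by (simp add: slash_def autJ_eq act_eq)

lemma Rop_slash:
  assumes F: "twice_diff F" and Z: "Z \<in> U"
  shows "slash B z \<zeta> Pp (m + 2) M (Rop B e b m F) Z = Rop B e b m (slash B z \<zeta> Pp m M F) Z"
proof -
  have "Rop B e b m (slash B z \<zeta> Pp m M F) Z =
      Rop B e b m (\<lambda>W. cnj (J W) powi 0 * J W powi (- m) * F (img W)) Z"
    by (rule Rop_cong[OF _ Z]) (simp add: slash_eq)
  also have "\<dots> = J Z powi (- m - 2) * Rop B e b m F (img Z)"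
    unfolding Rop_pullback[OF F Z] by simp
  finally show ?thesis by (simp add: slash_eq[OF Z])
qed

text \<open>The conjugate of the slashed function carries the factor
  \<open>cnj J powi (- m)\<close>, so \<open>Rop_pullback\<close> is used with weight 0 and r = -m.
  Conjugating back leaves the factor \<open>cnj J powi (- 2)\<close>, which \<open>(Y^2)^2\<close>
  absorbs in exchange for \<open>J^2\<close> by \<open>Ysq_img\<close>.\<close>

lemma Lop_slash:
  assumes F: "twice_diff (\<lambda>W. cnj (F W))" and Z: "Z \<in> U"
  shows "slash B z \<zeta> Pp (m - 2) M (Lop B e b F) Z = Lop B e b (slash B z \<zeta> Pp m M F) Z"
proof -
  define R where "R = Rop B e b 0 (\<lambda>W. cnj (F W)) (img Z)"
  define y where "y = complex_of_real (Ysq B (img Z))"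
  have pos: "0 < Ysq B Z" "0 < Ysq B (img Z)" using Ysq_pos Z img_in_tube by auto
  have yZ: "complex_of_real (Ysq B Z) = y * (J Z * cnj (J Z))"
    using Ysq_img[OF Z] by (simp add: y_def)
  have "Rop B e b 0 (\<lambda>W. cnj (slash B z \<zeta> Pp m M F W)) Z =
      Rop B e b 0 (\<lambda>W. cnj (J W) powi (- m) * J W powi (- 0) * cnj (F (img W))) Z"
    by (rule Rop_cong[OF _ Z]) (simp add: slash_eq)
  also have "\<dots> = cnj (J Z) powi (- m) * J Z powi (- 2) * R"
    using Rop_pullback[OF F Z, of 0 "- m"] by (simp add: R_def)
  finally have "Lop B e b (slash B z \<zeta> Pp m M F) Z =
      (complex_of_real (Ysq B Z))\<^sup>2 * (J Z powi (- m) * cnj (J Z) powi (- 2) * cnj R)"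
    using pos by (simp add: Lop_eq Ypow_def powr_numeral)
  also have "\<dots> = J Z powi (- (m - 2)) * (y\<^sup>2 * cnj R)"
    unfolding yZ using J_nonzero[OF Z]
    by (simp add: power_int_diff power_int_minus power2_eq_square field_simps)
  also have "\<dots> = slash B z \<zeta> Pp (m - 2) M (Lop B e b F) Z"
    using pos by (simp add: slash_eq[OF Z] Lop_eq Ypow_def powr_numeral y_def R_def)
  finally show ?thesis ..
qed

end

theorem theorem1p1:
  fixes B :: "'v::euclidean_space \<Rightarrow> 'v \<Rightarrow> real"
    and b :: nat and z \<zeta> :: 'v and Pp :: "'v cvec set" and e :: "nat \<Rightarrow> 'v"
  assumes "b \<ge> 1"
    and "quadratic_space B 2 b"
    and "Pp \<in> components (Pset B)"
    and "z \<noteq> 0" and "B z z = 0" and "B z \<zeta> = 1"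
    and "orthonormal_basis B (KR B z \<zeta>) 1 (b - 1) e"
  shows "(\<forall>(m::int) F. C2_on (tube B z \<zeta> Pp) F \<longrightarrow> (\<forall>Z\<in>tube B z \<zeta> Pp.
           Rop B e b m F Z =
             Deltah e b F Z
             - \<i> * of_real (2 * of_int m + 2 - real b) / of_real (Ysq B Z) * Dstar e b F Z
             - of_real (of_int m * (2 * of_int m + 2 - real b) / (2 * Ysq B Z)) * F Z)) \<and>
         (\<forall>F. C2_on (tube B z \<zeta> Pp) F \<longrightarrow> (\<forall>Z\<in>tube B z \<zeta> Pp.
           Lop B e b F Z = Ypow B (real b / 2 + 1) (Deltahbar e b (Ypow B (1 - real b / 2) F)) Z \<and>
           Lop B e b F Z =
             of_real ((Ysq B Z)\<^sup>2) * Deltahbar e b F Z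
             + \<i> * of_real (Ysq B Z * (2 - real b)) * Dstarbar e b F Z)) \<and>
         (\<forall>(m::int) F M. C2_on (tube B z \<zeta> Pp) F \<and> M \<in> Oplus B Pp \<longrightarrow> (\<forall>Z\<in>tube B z \<zeta> Pp.
           slash B z \<zeta> Pp (m + 2) M (Rop B e b m F) Z = Rop B e b m (slash B z \<zeta> Pp m M F) Z \<and>
           slash B z \<zeta> Pp (m - 2) M (Lop B e b F) Z = Lop B e b (slash B z \<zeta> Pp m M F) Z))"
proof -
  interpret tube_domain B b z \<zeta> Pp e
    using assms by unfold_locales (simp_all add: quadratic_space_def)
  have aut: "tube_automorphism B b z \<zeta> Pp e M" if "M \<in> Oplus B Pp" for M
    using that by unfold_locales
  show ?thesis
    using Rop_expansion Lop_expansions C2_on_twice_diff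
      tube_automorphism.Rop_slash[OF aut] tube_automorphism.Lop_slash[OF aut]
    by (intro conjI allI impI ballI) auto
qed

end
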